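(* Let $K$ be a field of characteristic $0$ with algebraic closure $\bar K$, $\Gamma=\operatorname{Gal}(\bar K/K)$, and let $G$ be a connected reductive $K$-group with center $Z$; let $\rho\colon G^{\mathrm{sc}}\to G$ be the canonical homomorphism from the universal covering $G^{\mathrm{sc}}$ of the derived group of $G$, and let $Z^{(\mathrm{sc})}$ be the center of $G^{\mathrm{sc}}$. Let $g \in H^{0}(K,G) = G(K)$. Write $g = \rho(g') \cdot z$ where $g' \in G^{\mathrm{sc}}(\bar{K})$, $z \in Z(\bar{K})$. Then $$\mathrm{ab}^{0}(g) = \mathrm{Cl}(\varphi, z)\in \mathbf{H}^0(K,Z^{(\mathrm{sc})}\to Z)=H^0_{\mathrm{ab}}(K,G),$$ where the map $\varphi\colon \Gamma \to Z^{(\mathrm{sc})}(\bar{K})$ is defined by $\varphi(\sigma) = (g')^{-1} \cdot {}^{\sigma}g'$.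
   Context: $G^{\mathrm{ss}}$ is the derived group of $G$ (semisimple), $G^{\mathrm{sc}}\to G^{\mathrm{ss}}$ its universal (simply connected) covering, and $\rho$ is the composition $G^{\mathrm{sc}}\to G^{\mathrm{ss}}\to G$. The conjugation action of $G$ on $G^{\mathrm{ss}}$ lifts uniquely to an action of $G$ on $G^{\mathrm{sc}}$. With this action $\rho\colon G^{\mathrm{sc}}\to G$ is a crossed module of $K$-groups, i.e. (on $\bar K$-points) $ff'f^{-1}={}^{\rho(f)}f'$ and $\rho({}^{g}f)=g\rho(f)g^{-1}$. For a crossed module of algebraic $K$-groups $\alpha\colon F\to G$, taking $\bar K$-points gives a crossed module of discrete groups with continuous $\Gamma$-action (the $\Gamma$-action is compatible with $\alpha$ and with the action of $G$ on $F$). $\mathbf{H}^0(K,F\to G)$ is defined as follows. $Z^0$ is the set of pairs $(\varphi,g)$ with $\varphi\colon\Gamma\to F(\bar K)$ continuous ($F(\bar K)$ discrete) and $g\in G(\bar K)$ such that $\varphi(\sigma\tau)=\varphi(\sigma)\cdot{}^{\sigma}\varphi(\tau)$ and ${}^{\sigma}g=\alpha(\varphi(\sigma)^{-1})\cdot g$ for all $\sigma,\tau\in\Gamma$. The group $F(\bar K)$ acts on $Z^0$ on the right by $(\varphi,g)*f=(\varphi',g')$, $\varphi'(\sigma)=f^{-1}\varphi(\sigma)\,{}^{\sigma}f$, $g'=\alpha(f)^{-1}g$. Then $\mathbf{H}^0(K,F\to G)=Z^0/F(\bar K)$, and $\mathrm{Cl}(\varphi,g)$ denotes the class of $(\varphi,g)$.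 The inclusion $(Z^{(\mathrm{sc})}\to Z)\hookrightarrow(G^{\mathrm{sc}}\to G)$ of crossed modules (with trivial action of $Z$ on $Z^{(\mathrm{sc})}$) induces isomorphisms on kernels and on cokernels, and it induces a bijection $\mathbf{H}^0(K,Z^{(\mathrm{sc})}\to Z)\xrightarrow{\sim}\mathbf{H}^0(K,G^{\mathrm{sc}}\to G)$. The abelian Galois cohomology is $H^0_{\mathrm{ab}}(K,G)=\mathbf{H}^0(K,Z^{(\mathrm{sc})}\to Z)$. The abelianization map $\mathrm{ab}^0$ is the composition $$H^0(K,G)=G(K)\xrightarrow{\varkappa_0}\mathbf{H}^0(K,G^{\mathrm{sc}}\to G)\xrightarrow{\sim}\mathbf{H}^0(K,Z^{(\mathrm{sc})}\to Z)=H^0_{\mathrm{ab}}(K,G),$$ where $\varkappa_0(g)=\mathrm{Cl}(1,g)$ and the second arrow is the inverse of the bijection $\mathbf{H}^0(K,Z^{(\mathrm{sc})}\to Z)\xrightarrow{\sim}\mathbf{H}^0(K,G^{\mathrm{sc}}\to G)$ induced by the inclusion $(Z^{(\mathrm{sc})}\to Z)\hookrightarrow(G^{\mathrm{sc}}\to G)$. *)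

theory Defs
  imports
    "HOL-Algebra.Algebraic_Closure_Type"
    "HOL-Algebra.Solvable_Groups"
    "HOL-Analysis.Abstract_Topology"
    "Jordan_Normal_Form.Determinant"
begin

section \<open>Linear algebraic groups\<close>

text \<open>
  The field \<open>K\<close> is a type \<open>'k\<close> of class \<open>field_char_0\<close>, its algebraic closure is the type
  \<open>'k alg_closure\<close>, with the embedding \<open>to_ac\<close>.  As \<open>K\<close> has characteristic 0, algebraic groups are
  reduced and \<open>K\<close> is perfect, so an affine algebraic \<open>K\<close>-group is the same thing as its group of
  points over the algebraic closure, embedded in some \<open>GL\<^sub>n\<close> as the set of zeros of polynomials with
  coefficients in \<open>K\<close>.  The parameter \<open>C\<close> below is the set of allowed coefficients: it is \<open>K\<close> for
  notions over \<open>K\<close>, and \<open>UNIV\<close> for geometric notions (over the algebraic closure).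
\<close>

definition base_field :: "'k::field alg_closure set" where
  "base_field = range to_ac"

definition GL :: "nat \<Rightarrow> 'a::field mat monoid" where
  "GL n = units_of (ring_mat TYPE('a) n ())"

abbreviation grp :: "nat \<Rightarrow> 'a::field mat set \<Rightarrow> 'a mat monoid" where
  "grp n G \<equiv> (GL n)\<lparr>carrier := G\<rparr>"

text \<open>The coordinate ring \<open>C[x\<^sub>i\<^sub>j, 1/det]\<close> of \<open>GL\<^sub>n\<close>, as a ring of functions.\<close>

inductive_set regular_funs :: "'a::field set \<Rightarrow> nat \<Rightarrow> ('a mat \<Rightarrow> 'a) set"
  for C :: "'a set" and n :: nat
where
  const: "c \<in> C \<Longrightarrow> (\<lambda>_. c) \<in> regular_funs C n"
| entry: "i < n \<Longrightarrow> j < n \<Longrightarrow> (\<lambda>A. A $$ (i, j)) \<in> regular_funs C n"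
| inv_det: "(\<lambda>A. inverse (det A)) \<in> regular_funs C n"
| add: "p \<in> regular_funs C n \<Longrightarrow> q \<in> regular_funs C n \<Longrightarrow> (\<lambda>A. p A + q A) \<in> regular_funs C n"
| mult: "p \<in> regular_funs C n \<Longrightarrow> q \<in> regular_funs C n \<Longrightarrow> (\<lambda>A. p A * q A) \<in> regular_funs C n"

text \<open>
  The Zariski topology on \<open>GL\<^sub>n\<close>, generated by the principal open sets.  These are closed under
  finite intersections, so the closed sets are exactly the zero sets of families of regular functions.
\<close>

definition zariski :: "'a::field set \<Rightarrow> nat \<Rightarrow> 'a mat topology" where
  "zariski C n = topology_generated_by {{A \<in> carrier (GL n). p A \<noteq> 0} | p. p \<in> regular_funs C n}"

definition alg_group :: "'a::field set \<Rightarrow> nat \<Rightarrow> 'a mat set \<Rightarrow> bool" where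
  "alg_group C n G \<longleftrightarrow> subgroup G (GL n) \<and> closedin (zariski C n) G"

definition connected_group :: "nat \<Rightarrow> 'a::field mat set \<Rightarrow> bool" where
  "connected_group n G \<longleftrightarrow> connectedin (zariski UNIV n) G"

definition alg_hom ::
  "'a::field set \<Rightarrow> nat \<Rightarrow> 'a mat set \<Rightarrow> nat \<Rightarrow> 'a mat set \<Rightarrow> ('a mat \<Rightarrow> 'a mat) \<Rightarrow> bool" where
  "alg_hom C n G m H f \<longleftrightarrow>
     f \<in> hom (grp n G) (grp m H) \<and>
     (\<forall>i<m. \<forall>j<m. \<exists>p\<in>regular_funs C n. \<forall>A\<in>G. f A $$ (i, j) = p A)"

definition alg_iso ::
  "'a::field set \<Rightarrow> nat \<Rightarrow> 'a mat set \<Rightarrow> nat \<Rightarrow> 'a mat set \<Rightarrow> ('a mat \<Rightarrow> 'a mat) \<Rightarrow> bool" where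
  "alg_iso C n G m H f \<longleftrightarrow>
     alg_hom C n G m H f \<and>
     (\<exists>f'. alg_hom C m H n G f' \<and> (\<forall>x\<in>G. f' (f x) = x) \<and> (\<forall>y\<in>H. f (f' y) = y))"

definition isogeny ::
  "'a::field set \<Rightarrow> nat \<Rightarrow> 'a mat set \<Rightarrow> nat \<Rightarrow> 'a mat set \<Rightarrow> ('a mat \<Rightarrow> 'a mat) \<Rightarrow> bool" where
  "isogeny C n G m H f \<longleftrightarrow>
     alg_hom C n G m H f \<and> f ` G = H \<and> finite (kernel (grp n G) (grp m H) f)"

definition unipotent_group :: "nat \<Rightarrow> 'a::field mat set \<Rightarrow> bool" where
  "unipotent_group n U \<longleftrightarrow> (\<forall>u\<in>U. \<exists>k. (u - 1\<^sub>m n) ^\<^sub>m k = 0\<^sub>m n n)"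

text \<open>Triviality of the unipotent radical, respectively of the radical.\<close>

definition connected_reductive :: "nat \<Rightarrow> 'a::field mat set \<Rightarrow> bool" where
  "connected_reductive n G \<longleftrightarrow>
     alg_group UNIV n G \<and> connected_group n G \<and>
     (\<forall>N. alg_group UNIV n N \<and> connected_group n N \<and> N \<lhd> grp n G \<and> unipotent_group n N
        \<longrightarrow> N = {1\<^sub>m n})"

definition connected_semisimple :: "nat \<Rightarrow> 'a::field mat set \<Rightarrow> bool" where
  "connected_semisimple n G \<longleftrightarrow>
     alg_group UNIV n G \<and> connected_group n G \<and>
     (\<forall>N. alg_group UNIV n N \<and> connected_group n N \<and> N \<lhd> grp n G \<and> solvable (grp n N)
        \<longrightarrow> N = {1\<^sub>m n})"

text \<open>In characteristic 0 every isogeny of connected groups is central, so centrality is not required.\<close>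

definition simply_connected :: "nat \<Rightarrow> 'a::field mat set \<Rightarrow> bool" where
  "simply_connected n G \<longleftrightarrow>
     connected_semisimple n G \<and>
     (\<forall>m H f. connected_semisimple m H \<and> isogeny UNIV m H n G f \<longrightarrow> alg_iso UNIV m H n G f)"

text \<open>
  The derived group \<open>G\<^sup>s\<^sup>s\<close> of a connected group \<open>G\<close> is closed, and its points over the algebraic
  closure form the abstract commutator subgroup.  The homomorphism \<open>\<rho>\<close> is regarded as a map to \<open>G\<close>.
\<close>

definition universal_covering ::
  "nat \<Rightarrow> 'k::field alg_closure mat set \<Rightarrow> nat \<Rightarrow> 'k alg_closure mat set \<Rightarrow>
   ('k alg_closure mat \<Rightarrow> 'k alg_closure mat) \<Rightarrow> bool" where
  "universal_covering n G m Gsc \<rho> \<longleftrightarrow>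
     alg_group base_field m Gsc \<and> simply_connected m Gsc \<and>
     isogeny base_field m Gsc n (derived (GL n) G) \<rho>"

text \<open>In characteristic 0 the scheme-theoretic center is reduced, hence given by its points.\<close>

definition center :: "('a, 'b) monoid_scheme \<Rightarrow> 'a set" where
  "center G = {z \<in> carrier G. \<forall>x\<in>carrier G. z \<otimes>\<^bsub>G\<^esub> x = x \<otimes>\<^bsub>G\<^esub> z}"


section \<open>The Galois group and its action\<close>

definition Gal :: "('k::field alg_closure \<Rightarrow> 'k alg_closure) set" where
  "Gal = {\<sigma>. field_isom \<sigma> \<and> (\<forall>c. \<sigma> (to_ac c) = to_ac c)}"

text \<open>
  The Krull topology: two automorphisms agree on the finite extension \<open>K(S)\<close> iff they agree on the
  finite set \<open>S\<close>, so the generators are the cosets of the subgroups fixing a finite extension of \<open>K\<close>.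
\<close>

definition krull :: "('k::field alg_closure \<Rightarrow> 'k alg_closure) topology" where
  "krull = topology_generated_by
     {{\<tau> \<in> Gal. \<forall>x\<in>S. \<tau> x = \<sigma> x} | \<sigma> S. \<sigma> \<in> Gal \<and> finite S}"

text \<open>\<open>H\<^sup>0(K, G)\<close> as Galois invariants; in characteristic 0 this is \<open>G(K)\<close>.\<close>

definition H0_gal :: "'k::field alg_closure mat set \<Rightarrow> 'k alg_closure mat set" where
  "H0_gal G = {g \<in> G. \<forall>\<sigma>\<in>Gal. map_mat \<sigma> g = g}"


section \<open>Hypercohomology of crossed modules\<close>

text \<open>
  A crossed module \<open>\<alpha> : F \<rightarrow> G\<close> together with the action of \<open>G\<close> on \<open>F\<close>, on points over the
  algebraic closure; \<open>Gal\<close> acts entrywise.  The set \<open>H0\<close> below depends on the groups and on \<open>\<alpha>\<close>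
  only: neither the action of \<open>G\<close> on \<open>F\<close> nor the crossed module identities enter its definition.
\<close>

record 'a crossed_module =
  source :: "'a mat monoid"
  target :: "'a mat monoid"
  boundary :: "'a mat \<Rightarrow> 'a mat"
  action :: "'a mat \<Rightarrow> 'a mat \<Rightarrow> 'a mat"

type_synonym 'k hyper_cocycle =
  "(('k alg_closure \<Rightarrow> 'k alg_closure) \<Rightarrow> 'k alg_closure mat) \<times> 'k alg_closure mat"

text \<open>Maps on \<open>Gal\<close> are made extensional, so that equality of cocycles is equality on \<open>Gal\<close>.\<close>

definition Z0 :: "'k::field alg_closure crossed_module \<Rightarrow> 'k hyper_cocycle set" where
  "Z0 M = {(\<phi>, g).
     \<phi> \<in> extensional Gal \<and>
     continuous_map krull (discrete_topology (carrier (source M))) \<phi> \<and>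
     g \<in> carrier (target M) \<and>
     (\<forall>\<sigma>\<in>Gal. \<forall>\<tau>\<in>Gal. \<phi> (\<sigma> \<circ> \<tau>) = \<phi> \<sigma> \<otimes>\<^bsub>source M\<^esub> map_mat \<sigma> (\<phi> \<tau>)) \<and>
     (\<forall>\<sigma>\<in>Gal. map_mat \<sigma> g = boundary M (inv\<^bsub>source M\<^esub> (\<phi> \<sigma>)) \<otimes>\<^bsub>target M\<^esub> g)}"

definition twist ::
  "'k::field alg_closure crossed_module \<Rightarrow> 'k hyper_cocycle \<Rightarrow> 'k alg_closure mat \<Rightarrow> 'k hyper_cocycle" where
  "twist M = (\<lambda>(\<phi>, g) f.
     (\<lambda>\<sigma>\<in>Gal. inv\<^bsub>source M\<^esub> f \<otimes>\<^bsub>source M\<^esub> \<phi> \<sigma> \<otimes>\<^bsub>source M\<^esub> map_mat \<sigma> f,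
      inv\<^bsub>target M\<^esub> (boundary M f) \<otimes>\<^bsub>target M\<^esub> g))"

definition cohomologous :: "'k::field alg_closure crossed_module \<Rightarrow> 'k hyper_cocycle rel" where
  "cohomologous M = {(x, y). x \<in> Z0 M \<and> y \<in> Z0 M \<and> (\<exists>f\<in>carrier (source M). y = twist M x f)}"

definition H0 :: "'k::field alg_closure crossed_module \<Rightarrow> 'k hyper_cocycle set set" where
  "H0 M = Z0 M // cohomologous M"

definition Cl :: "'k::field alg_closure crossed_module \<Rightarrow> 'k hyper_cocycle \<Rightarrow> 'k hyper_cocycle set" where
  "Cl M x = cohomologous M `` {x}"

text \<open>The map on \<open>H0\<close> induced by a morphism \<open>(a, b)\<close> of crossed modules; the union is over equal classes.\<close>

definition H0_map ::
  "'k::field alg_closure crossed_module \<Rightarrow> ('k alg_closure mat \<Rightarrow> 'k alg_closure mat) \<Rightarrow>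
   ('k alg_closure mat \<Rightarrow> 'k alg_closure mat) \<Rightarrow> 'k hyper_cocycle set \<Rightarrow> 'k hyper_cocycle set" where
  "H0_map N a b c = (\<Union>(\<phi>, g)\<in>c. Cl N (\<lambda>\<sigma>\<in>Gal. a (\<phi> \<sigma>), b g))"


section \<open>Abelianization\<close>

text \<open>
  For \<open>g \<in> G\<close>, the unique algebraic endomorphism of \<open>G\<^sup>s\<^sup>c\<close> lifting conjugation by \<open>g\<close> on \<open>G\<^sup>s\<^sup>s\<close>.
\<close>

definition lifted_conj ::
  "nat \<Rightarrow> nat \<Rightarrow> 'a::field mat set \<Rightarrow> ('a mat \<Rightarrow> 'a mat) \<Rightarrow> 'a mat \<Rightarrow> 'a mat \<Rightarrow> 'a mat" where
  "lifted_conj n m Gsc \<rho> g = (THE c. c \<in> extensional Gsc \<and> alg_hom UNIV m Gsc m Gsc c \<and>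
     (\<forall>f\<in>Gsc. \<rho> (c f) = g \<otimes>\<^bsub>GL n\<^esub> \<rho> f \<otimes>\<^bsub>GL n\<^esub> inv\<^bsub>GL n\<^esub> g))"

definition sc_module ::
  "nat \<Rightarrow> 'a::field mat set \<Rightarrow> nat \<Rightarrow> 'a mat set \<Rightarrow> ('a mat \<Rightarrow> 'a mat) \<Rightarrow> 'a crossed_module" where
  "sc_module n G m Gsc \<rho> =
     \<lparr>source = grp m Gsc, target = grp n G, boundary = \<rho>, action = lifted_conj n m Gsc \<rho>\<rparr>"

definition center_module ::
  "nat \<Rightarrow> 'a::field mat set \<Rightarrow> nat \<Rightarrow> 'a mat set \<Rightarrow> ('a mat \<Rightarrow> 'a mat) \<Rightarrow> 'a crossed_module" where
  "center_module n G m Gsc \<rho> =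
     \<lparr>source = grp m (center (grp m Gsc)), target = grp n (center (grp n G)),
      boundary = \<rho>, action = (\<lambda>_ f. f)\<rparr>"

definition H0_ab ::
  "nat \<Rightarrow> 'k::field alg_closure mat set \<Rightarrow> nat \<Rightarrow> 'k alg_closure mat set \<Rightarrow>
   ('k alg_closure mat \<Rightarrow> 'k alg_closure mat) \<Rightarrow> 'k hyper_cocycle set set" where
  "H0_ab n G m Gsc \<rho> = H0 (center_module n G m Gsc \<rho>)"

definition kappa0 :: "'k::field alg_closure crossed_module \<Rightarrow> 'k alg_closure mat \<Rightarrow> 'k hyper_cocycle set" where
  "kappa0 M g = Cl M (\<lambda>\<sigma>\<in>Gal. \<one>\<^bsub>source M\<^esub>, g)"

definition ab0 ::
  "nat \<Rightarrow> 'k::field alg_closure mat set \<Rightarrow> nat \<Rightarrow> 'k alg_closure mat set \<Rightarrow>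
   ('k alg_closure mat \<Rightarrow> 'k alg_closure mat) \<Rightarrow> 'k alg_closure mat \<Rightarrow> 'k hyper_cocycle set" where
  "ab0 n G m Gsc \<rho> g =
     the_inv_into (H0_ab n G m Gsc \<rho>) (H0_map (sc_module n G m Gsc \<rho>) id id)
       (kappa0 (sc_module n G m Gsc \<rho>) g)"

end

theory Submission
  imports Defs "HOL-Library.Function_Algebras"
begin

text \<open>
  In the crossed module \<open>Gsc \<rightarrow> G\<close>, twisting \<open>(1, g)\<close> by \<open>g'\<close> gives \<open>(\<phi>, z)\<close>, so what matters is that
  \<open>(\<phi>, z)\<close> is a cocycle with values in the centers and that passing from the centers to \<open>Gsc \<rightarrow> G\<close>
  is injective on classes.  Both follow from two facts about centers.  An element \<open>c\<close> of \<open>Gsc\<close>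
  whose image is central is itself central, because \<open>x \<mapsto> [c, x]\<close> maps the connected group \<open>Gsc\<close> into
  the finite kernel of \<open>\<rho>\<close>.  Conversely \<open>\<rho>\<close> maps the center of \<open>Gsc\<close> into that of \<open>G\<close>, because the
  connected group \<open>G\<close> acts by conjugation on the finite center of its derived group.  Finiteness of the
  center of a semisimple group uses that the Zariski topology is Noetherian (Hilbert's basis theorem).
\<close>

section \<open>Noetherian subrings\<close>

text \<open>The Galois input is the identity \<rho>(\<phi>(\<sigma>)) = z (\<sigma> z)^-1, read off
  from \<sigma> g = g. Likewise an f carrying one cocycle with values in the centers, with second
  component g, to another, with second component h, satisfies \<rho>(f) = g h^-1. So both the values
  of \<phi> and such an f are central by the first fact about centers; the second fact is what makes
  \<rho> a homomorphism from \<open>Zsc\<close> to \<open>Z\<close> at all. The obstacle is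
  topological: \<open>GL n\<close> with the Zariski topology is in general not a topological group,
  so connectedness is exploited through closed sets and translations alone. The fibre c x = k x c of
  the commutator map is given by equations linear in x, and finitely many values k cut a connected
  group into disjoint closed pieces. Semisimplicity kills the identity component of the center,
  which leaves a discrete space; Noetherianity makes it compact, hence finite. Regular functions are
  genuine functions on matrices, so Noetherian rings are treated as subsets of a commutative ring
  type, here the ring of functions under pointwise operations.\<close>

definition subring_of :: "'a::comm_ring_1 set \<Rightarrow> bool" where
  "subring_of R \<longleftrightarrow> 0 \<in> R \<and> 1 \<in> R \<and>
     (\<forall>a\<in>R. - a \<in> R) \<and> (\<forall>a\<in>R. \<forall>b\<in>R. a + b \<in> R \<and> a * b \<in> R)"

inductive_set ideal_span :: "'a::comm_ring_1 set \<Rightarrow> 'a set \<Rightarrow> 'a set" for R A where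
  zero: "0 \<in> ideal_span R A"
| step: "r \<in> R \<Longrightarrow> a \<in> A \<Longrightarrow> y \<in> ideal_span R A \<Longrightarrow> r * a + y \<in> ideal_span R A"

text \<open>The generators \<open>F\<close> are drawn from the given set \<open>P\<close> itself,
  which need not be an ideal. Hilbert's proof uses this to recover indices of a sequence, the
  compactness proof to recover members of a cover.\<close>

definition noetherian :: "'a::comm_ring_1 set \<Rightarrow> bool" where
  "noetherian R \<longleftrightarrow> (\<forall>P\<subseteq>R. \<exists>F\<subseteq>P. finite F \<and> P \<subseteq> ideal_span R F)"

lemma ideal_span_add:
  "x \<in> ideal_span R A \<Longrightarrow> y \<in> ideal_span R A \<Longrightarrow> x + y \<in> ideal_span R A"
  by (induction rule: ideal_span.induct) (auto simp: add.assoc intro: ideal_span.intros)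

lemma ideal_span_mult:
  assumes "subring_of R" "s \<in> R" "x \<in> ideal_span R A"
  shows "s * x \<in> ideal_span R A"
  using assms(3)
proof induction
  case (step r a y)
  have "s * r \<in> R" using assms step by (auto simp: subring_of_def)
  from ideal_span.step[OF this step(2,4)] show ?case by (simp add: algebra_simps)
qed (auto intro: ideal_span.intros)

lemma ideal_span_base:
  assumes "subring_of R" "a \<in> A"
  shows "a \<in> ideal_span R A"
  using ideal_span.step[of 1 R a A 0] assms by (auto simp: subring_of_def intro: ideal_span.intros)

lemma ideal_span_trans:
  assumes "subring_of R" "A \<subseteq> ideal_span R B"
  shows "ideal_span R A \<subseteq> ideal_span R B"
proof
  show "x \<in> ideal_span R B" if "x \<in> ideal_span R A" for x
    using that
    by induction (use assms in \<open>auto intro: ideal_span.zero ideal_span_add ideal_span_mult\<close>)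
qed

lemma ideal_span_mono:
  assumes "A \<subseteq> B"
  shows "ideal_span R A \<subseteq> ideal_span R B"
proof
  show "x \<in> ideal_span R B" if "x \<in> ideal_span R A" for x
    using that by induction (use assms in \<open>auto intro: ideal_span.intros\<close>)
qed

lemma ideal_span_finite_support:
  assumes "x \<in> ideal_span R A"
  shows "\<exists>F\<subseteq>A. finite F \<and> x \<in> ideal_span R F"
  using assms
proof induction
  case (step r a y)
  then obtain F where F: "F \<subseteq> A" "finite F" "y \<in> ideal_span R F" by auto
  have "y \<in> ideal_span R (insert a F)" using F ideal_span_mono[of F "insert a F" R] by auto
  then have "r * a + y \<in> ideal_span R (insert a F)" using step by (auto intro: ideal_span.step)
  then show ?case using F step by (intro exI[of _ "insert a F"]) auto
qed (auto intro: ideal_span.zero)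

lemma ideal_span_finite_support_subset:
  assumes "subring_of R" "finite J" "J \<subseteq> ideal_span R A"
  shows "\<exists>F\<subseteq>A. finite F \<and> J \<subseteq> ideal_span R F"
proof -
  have "\<forall>x\<in>J. \<exists>F\<subseteq>A. finite F \<and> x \<in> ideal_span R F"
    using assms ideal_span_finite_support by blast
  then obtain F where F: "\<forall>x\<in>J. F x \<subseteq> A \<and> finite (F x) \<and> x \<in> ideal_span R (F x)"
    by metis
  then have "J \<subseteq> ideal_span R (\<Union>x\<in>J. F x)"
    using ideal_span_mono[of "F _" "\<Union>x\<in>J. F x" R] by blast
  with F assms show ?thesis by (intro exI[of _ "\<Union>x\<in>J. F x"]) auto
qed

lemma ideal_span_uminus:
  assumes "subring_of R" "x \<in> ideal_span R A"
  shows "- x \<in> ideal_span R A"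
  using ideal_span_mult[OF assms(1) _ assms(2), of "- 1"] assms(1) by (auto simp: subring_of_def)

lemma ideal_span_image:
  assumes "\<And>x y. f (x + y) = f x + f y" "\<And>x y. f (x * y) = f x * f y" "f 0 = 0"
    and "x \<in> ideal_span R A"
  shows "f x \<in> ideal_span (f ` R) (f ` A)"
  using assms(4) by induction (auto simp: assms(1-3) intro: ideal_span.intros)

text \<open>A subset of the image is the image of some \<open>Q\<close> inside \<open>R\<close>;
  generators chosen in \<open>Q\<close> are pushed forward.\<close>

lemma noetherian_image:
  assumes "\<And>x y. f (x + y) = f x + f y" "\<And>x y. f (x * y) = f x * f y" "f 0 = 0"
    and "noetherian R"
  shows "noetherian (f ` R)"
  unfolding noetherian_def
proof (intro allI impI)
  fix P assume "P \<subseteq> f ` R"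
  then obtain Q where Q: "Q \<subseteq> R" "P = f ` Q" by (meson subset_imageE)
  then obtain F where F: "F \<subseteq> Q" "finite F" "Q \<subseteq> ideal_span R F"
    using assms(4) unfolding noetherian_def by blast
  then show "\<exists>F\<subseteq>P. finite F \<and> P \<subseteq> ideal_span (f ` R) F"
    using Q ideal_span_image[OF assms(1-3)] by (intro exI[of _ "f ` F"]) auto
qed

text \<open>One nonzero element spans everything. Inverses are required inside \<open>R\<close>
  because the lemma is applied to the constant functions, a field inside a function ring with zero
  divisors.\<close>

lemma noetherian_field:
  assumes "subring_of R" "\<And>a. a \<in> R \<Longrightarrow> a \<noteq> 0 \<Longrightarrow> \<exists>b\<in>R. b * a = 1"
  shows "noetherian R"
  unfolding noetherian_def
proof (intro allI impI)
  fix P assume P: "P \<subseteq> R"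
  show "\<exists>F\<subseteq>P. finite F \<and> P \<subseteq> ideal_span R F"
  proof (cases "P \<subseteq> {0}")
    case True
    then show ?thesis by (intro exI[of _ "{}"]) (auto intro: ideal_span.zero)
  next
    case False
    then obtain a where a: "a \<in> P" "a \<noteq> 0" by auto
    with P assms(2) obtain b where b: "b \<in> R" "b * a = 1" by auto
    have "p \<in> ideal_span R {a}" if "p \<in> P" for p
    proof -
      have "p * (b * a) \<in> ideal_span R {a}"
        using that P b assms(1) by (intro ideal_span_mult ideal_span_base) auto
      then show ?thesis using b by simp
    qed
    with a show ?thesis by (intro exI[of _ "{a}"]) auto
  qed
qed

section \<open>Polynomial rings and Hilbert's basis theorem\<close>

definition poly_subring :: "'a::comm_ring_1 set \<Rightarrow> 'a poly set" where
  "poly_subring R = {p. \<forall>i. coeff p i \<in> R}"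

lemma subring_of_sum: "subring_of R \<Longrightarrow> (\<And>i. i \<in> I \<Longrightarrow> f i \<in> R) \<Longrightarrow> sum f I \<in> R"
  by (induction I rule: infinite_finite_induct) (auto simp: subring_of_def)

lemma subring_poly_subring:
  assumes "subring_of R"
  shows "subring_of (poly_subring R)"
proof -
  have "(p * q) \<in> poly_subring R" if "p \<in> poly_subring R" "q \<in> poly_subring R" for p q
    using that assms unfolding poly_subring_def
    by (auto simp: coeff_mult subring_of_def intro!: subring_of_sum[OF assms])
  moreover have "coeff 1 i \<in> R" for i using assms by (cases i) (auto simp: subring_of_def)
  ultimately show ?thesis using assms
    by (auto simp: subring_of_def poly_subring_def)
qed

text \<open>Dependent choice in which the next term is constrained by the set of all earlier terms;
  it produces a sequence that keeps leaving the ideal of its predecessors.\<close>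

lemma ex_sequence_avoiding:
  assumes "\<And>xs. \<exists>y. Q xs y"
  shows "\<exists>f::nat \<Rightarrow> 'a. \<forall>k. Q (f ` {..<k}) (f k)"
proof (rule dependent_wellorder_choice)
  fix r x and f g :: "nat \<Rightarrow> 'a"
  assume "\<And>y. y < r \<Longrightarrow> f y = g y"
  then have "f ` {..<r} = g ` {..<r}" by (intro image_cong) auto
  then show "Q (f ` {..<r}) x = Q (g ` {..<r}) x" by simp
qed (rule assms)

text \<open>Otherwise pick \<open>g k\<close> of least degree outside the ideal of the earlier \<open>g i\<close>; a relation between
  the leading coefficients then lowers the degree of some \<open>g k\<close>.\<close>

theorem hilbert_basis:
  assumes R: "subring_of R" and N: "noetherian R"
  shows "noetherian (poly_subring R)"
proof (rule ccontr)
  let ?S = "poly_subring R"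
  have S: "subring_of ?S" using R by (rule subring_poly_subring)
  assume "\<not> noetherian ?S"
  then obtain P where P: "P \<subseteq> ?S" "\<And>F. F \<subseteq> P \<Longrightarrow> finite F \<Longrightarrow> \<not> P \<subseteq> ideal_span ?S F"
    unfolding noetherian_def by blast
  define I where "I = ideal_span ?S P"
  have I_S: "I \<subseteq> ?S"
  proof
    fix x assume "x \<in> I"
    then show "x \<in> ?S" unfolding I_def
      by induction (use S P in \<open>auto simp: subring_of_def\<close>)
  qed
  \<comment> \<open>The assumption on \<open>P\<close> speaks only of finite subsets of
    \<open>P\<close>. A finite \<open>J\<close> in the ideal \<open>I\<close> lies in the ideal of
    finitely many elements of \<open>P\<close>, so it cannot generate \<open>I\<close>
    either.\<close>
  have ex: "I - ideal_span ?S J \<noteq> {}" if J: "finite J" "J \<subseteq> I" for J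
  proof -
    obtain F where F: "F \<subseteq> P" "finite F" "J \<subseteq> ideal_span ?S F"
      using ideal_span_finite_support_subset[OF S J(1)] J(2) I_def by blast
    from P(2)[OF F(1,2)] obtain p where "p \<in> P" "p \<notin> ideal_span ?S F" by auto
    then show ?thesis using ideal_span_trans[OF S F(3)] ideal_span_base[OF S, of p P] I_def by auto
  qed
  \<comment> \<open>The guard makes \<open>Q J\<close> satisfiable for every \<open>J\<close>, as
    \<open>ex_sequence_avoiding\<close> demands; that it holds along the sequence is the induction
    \<open>gI\<close>.\<close>
  define Q where "Q J y \<longleftrightarrow> (finite J \<and> J \<subseteq> I \<longrightarrow> y \<in> I - ideal_span ?S J \<and>
     (\<forall>x\<in>I - ideal_span ?S J. degree y \<le> degree x))" for J y
  have "\<exists>y. Q J y" for J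
  proof (cases "finite J \<and> J \<subseteq> I")
    case True
    then obtain x where "x \<in> I - ideal_span ?S J" using ex by blast
    from ex_has_least_nat[of "\<lambda>x. x \<in> I - ideal_span ?S J" x degree, OF this] show ?thesis
      unfolding Q_def by blast
  qed (auto simp: Q_def)
  then have "\<exists>g. \<forall>k::nat. Q (g ` {..<k}) (g k)" by (rule ex_sequence_avoiding)
  then obtain g :: "nat \<Rightarrow> 'a poly" where g: "\<And>k. Q (g ` {..<k}) (g k)" by blast
  have gI: "g k \<in> I" for k
  proof (induction k rule: less_induct)
    case (less k)
    then show ?case using g[of k] unfolding Q_def by auto
  qed
  have g_new: "g k \<notin> ideal_span ?S (g ` {..<k})" for k
    using g[of k] gI unfolding Q_def by auto
  have g_min: "degree (g k) \<le> degree x" if "x \<in> I" "x \<notin> ideal_span ?S (g ` {..<k})" for x k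
    using g[of k] gI that unfolding Q_def by auto
  define a where "a k = lead_coeff (g k)" for k
  have "range a \<subseteq> R" using gI I_S by (auto simp: poly_subring_def a_def)
  then obtain F where F: "F \<subseteq> range a" "finite F" "range a \<subseteq> ideal_span R F"
    using N[unfolded noetherian_def, rule_format, of "range a"] by auto
  obtain T where T: "finite T" "F = a ` T"
    using finite_subset_image[OF F(2,1)] by auto
  \<comment> \<open>\<open>M\<close> lies beyond every index in \<open>T\<close>, so
    \<open>a M\<close> is spanned by leading coefficients of strictly earlier terms. The inserted 0
    keeps \<open>Max\<close> defined when \<open>T\<close> is empty.\<close>
  define M where "M = Suc (Max (insert 0 T))"
  have TM: "k < M" if "k \<in> T" for k using T that by (simp add: M_def less_Suc_eq_le)
  let ?d = "degree (g M)" and ?J = "ideal_span ?S (g ` {..<M})"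
  have deg_le: "degree (g k) \<le> ?d" if "k < M" for k
  proof (rule g_min[OF gI])
    have "ideal_span ?S (g ` {..<k}) \<subseteq> ?J" using that by (intro ideal_span_mono) auto
    then show "g M \<notin> ideal_span ?S (g ` {..<k})" using g_new[of M] by auto
  qed
  \<comment> \<open>Multiplying each \<open>g k\<close> by a monomial raises it to degree at most
    \<open>?d\<close> with its leading coefficient in position \<open>?d\<close>. Sums may cancel
    there, hence the claim about \<open>coeff h ?d\<close> rather than
    \<open>lead_coeff h\<close>.\<close>
  have "\<exists>h\<in>?J. degree h \<le> ?d \<and> coeff h ?d = b" if "b \<in> ideal_span R F" for b
    using that
  proof induction
    case zero
    show ?case by (intro bexI[of _ 0]) (auto intro: ideal_span.zero)
  next
    case (step r b y)
    then obtain h where h: "h \<in> ?J" "degree h \<le> ?d" "coeff h ?d = y" by auto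
    from step T a_def obtain k where k: "k \<in> T" "b = lead_coeff (g k)" by auto
    have kM: "k < M" using TM k by auto
    let ?m = "monom r (?d - degree (g k))"
    have m: "?m \<in> ?S" using step R by (auto simp: poly_subring_def subring_of_def)
    have "degree (?m * g k) \<le> ?d"
      using degree_mult_le[of ?m "g k"] degree_monom_le[of r "?d - degree (g k)"] deg_le[OF kM]
      by linarith
    moreover have "coeff (?m * g k) ?d = r * b"
      using deg_le[OF kM] k by (simp add: coeff_monom_mult)
    ultimately show ?case using h m kM
      by (intro bexI[of _ "?m * g k + h"]) (auto intro: degree_add_le ideal_span.step)
  qed
  moreover have "a M \<in> ideal_span R F" using F(3) by auto
  ultimately obtain h where h: "h \<in> ?J" "degree h \<le> ?d" "coeff h ?d = lead_coeff (g M)"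
    using a_def by metis
  let ?x = "g M - h"
  have J_I: "?J \<subseteq> I" unfolding I_def
    by (rule ideal_span_trans[OF S]) (use gI in \<open>auto simp: I_def\<close>)
  have x_new: "?x \<notin> ?J"
    using ideal_span_add[of ?x ?S "g ` {..<M}" h] h g_new[of M] by auto
  have x_I: "?x \<in> I"
    using ideal_span_add[of "g M" ?S P "- h"] ideal_span_uminus[OF S, of h P] h J_I gI
    by (auto simp: I_def)
  \<comment> \<open>Equal degrees together with a vanishing coefficient in that degree force
    \<open>?x = 0\<close>. This also covers \<open>?d = 0\<close>, where the degree cannot drop
    strictly.\<close>
  have "degree ?x \<le> ?d" using h(2) by (intro degree_diff_le) auto
  moreover have "?d \<le> degree ?x" using g_min[OF x_I x_new] .
  moreover have "coeff ?x ?d = 0" using h(3) by simp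
  ultimately have "?x = 0" by (metis le_antisym leading_coeff_0_iff)
  then show False using x_new by (auto intro: ideal_span.zero)
qed

lemma subring_image:
  assumes "\<And>x y. f (x + y) = f x + f y" "\<And>x y. f (x * y) = f x * f y" "f 0 = 0" "f 1 = 1"
    and "\<And>x. f (- x) = - f x" "subring_of R"
  shows "subring_of (f ` R)"
proof -
  have "0 \<in> f ` R" "1 \<in> f ` R"
    using assms(3,4,6) unfolding subring_of_def by (metis imageI)+
  moreover have "- f a \<in> f ` R" "f a + f b \<in> f ` R" "f a * f b \<in> f ` R" if "a \<in> R" "b \<in> R" for a b
    using assms(6) that unfolding subring_of_def assms(1,2,5)[symmetric] by auto
  ultimately show ?thesis unfolding subring_of_def by auto
qed

text \<open>\<open>S\<close> is R[x], the image of the polynomial ring under evaluation at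
  \<open>x\<close>; algebraic relations satisfied by \<open>x\<close> do no harm.\<close>

lemma noetherian_adjoin:
  assumes R: "subring_of R" "noetherian R"
  shows "\<exists>S. subring_of S \<and> noetherian S \<and> R \<subseteq> S \<and> x \<in> S"
proof (intro exI conjI)
  let ?f = "\<lambda>p. poly p x" and ?S = "(\<lambda>p. poly p x) ` poly_subring R"
  show "subring_of ?S" by (rule subring_image) (auto intro: subring_poly_subring R)
  show "noetherian ?S" by (rule noetherian_image) (auto intro: hilbert_basis R)
  have "[:a:] \<in> poly_subring R" if "a \<in> R" for a
    using that R by (auto simp: poly_subring_def subring_of_def coeff_pCons split: nat.splits)
  then show "R \<subseteq> ?S" by (force intro: image_eqI[of _ ?f "[:_:]"])
  have "[:0, 1:] \<in> poly_subring R"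
    using R by (auto simp: poly_subring_def subring_of_def coeff_pCons split: nat.splits)
  then show "x \<in> ?S" by (force intro: image_eqI[of _ ?f "[:0, 1:]"])
qed

lemma noetherian_adjoin_finite:
  assumes "subring_of R" "noetherian R" "finite B"
  shows "\<exists>S. subring_of S \<and> noetherian S \<and> R \<subseteq> S \<and> B \<subseteq> S"
  using assms(3)
proof (induction)
  case empty
  then show ?case using assms by auto
next
  case (insert x B)
  then obtain S where "subring_of S" "noetherian S" "R \<subseteq> S \<and> B \<subseteq> S" by auto
  with noetherian_adjoin[of S x] show ?case by blast
qed

section \<open>The Zariski topology\<close>

lemma carrier_GL: "carrier (GL n) = {A \<in> carrier_mat n n. det A \<noteq> 0}"
proof -
  have "A \<in> Units (ring_mat TYPE('a) n ()) \<longleftrightarrow> A \<in> carrier_mat n n \<and> det A \<noteq> 0" for A :: "'a mat"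
    using unit_imp_det_non_zero[of A n "()"] det_non_zero_imp_unit[of A n "()"]
    by (auto simp: Units_def ring_mat_simps)
  then show ?thesis by (auto simp: GL_def units_of_carrier)
qed

lemma GL_simps [simp]: "monoid.mult (GL n) = (*)" "monoid.one (GL n) = 1\<^sub>m n"
  by (simp_all add: GL_def units_of_mult units_of_one ring_mat_simps)

lemma group_GL: "group (GL n)"
proof -
  interpret ring "ring_mat TYPE('a) n ()" by (rule ring_mat)
  show ?thesis unfolding GL_def by (rule units_group)
qed

lemma GL_carrier_mat: "A \<in> carrier (GL n) \<Longrightarrow> A \<in> carrier_mat n n"
  by (simp add: carrier_GL)

lemma regular_funs_diff:
  assumes "p \<in> regular_funs UNIV n" "q \<in> regular_funs UNIV n"
  shows "(\<lambda>A. p A - q A) \<in> regular_funs UNIV n"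
proof -
  have "(\<lambda>A. p A + (- 1) * q A) \<in> regular_funs UNIV n"
    by (intro regular_funs.add regular_funs.mult regular_funs.const assms) auto
  then show ?thesis by simp
qed

lemma regular_funs_sum:
  "(\<And>i. i \<in> I \<Longrightarrow> f i \<in> regular_funs UNIV n) \<Longrightarrow> (\<lambda>A. \<Sum>i\<in>I. f i A) \<in> regular_funs UNIV n"
  by (induction I rule: infinite_finite_induct) (auto intro: regular_funs.intros)

lemma regular_funs_bimult:
  assumes "a \<in> carrier_mat n n" "b \<in> carrier_mat n n" "i < n" "j < n"
  shows "\<exists>p\<in>regular_funs UNIV n. \<forall>A\<in>carrier_mat n n. (a * A * b) $$ (i, j) = p A"
proof
  show "(\<lambda>A. \<Sum>l<n. (\<Sum>k<n. a $$ (i, k) * A $$ (k, l)) * b $$ (l, j)) \<in> regular_funs UNIV n"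
    using assms by (intro regular_funs_sum regular_funs.mult regular_funs.const regular_funs.entry) auto
  show "\<forall>A\<in>carrier_mat n n.
      (a * A * b) $$ (i, j) = (\<Sum>l<n. (\<Sum>k<n. a $$ (i, k) * A $$ (k, l)) * b $$ (l, j))"
    using assms by (auto simp: scalar_prod_def atLeast0LessThan simp del: assoc_mult_mat)
qed

lemma openin_principal:
  "p \<in> regular_funs C n \<Longrightarrow> openin (zariski C n) {A \<in> carrier (GL n). p A \<noteq> 0}"
  unfolding zariski_def by (rule topology_generated_by_Basis) auto

lemma topspace_zariski:
  assumes "1 \<in> C"
  shows "topspace (zariski C n) = carrier (GL n)"
proof
  show "topspace (zariski C n) \<subseteq> carrier (GL n)"
    unfolding zariski_def topology_generated_by_topspace by auto
  have "(\<lambda>_. 1) \<in> regular_funs C n" using assms by (rule regular_funs.const)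
  from openin_principal[OF this] have "openin (zariski C n) (carrier (GL n))" by simp
  then show "carrier (GL n) \<subseteq> topspace (zariski C n)" by (rule openin_subset)
qed

text \<open>The principal open sets are a base and not only a subbase: over a field, the product of
  two functions is nonzero exactly where both are.\<close>

lemma openin_zariski_principal:
  assumes "openin (zariski C n) V" "A \<in> V"
  shows "A \<in> carrier (GL n) \<and>
    (\<exists>p\<in>regular_funs C n. p A \<noteq> 0 \<and> {B \<in> carrier (GL n). p B \<noteq> 0} \<subseteq> V)"
  using assms unfolding zariski_def openin_topology_generated_by_iff
proof induction
  case (Int a b)
  from Int.IH(1) Int.prems obtain p where p: "A \<in> carrier (GL n)" "p \<in> regular_funs C n"
    "p A \<noteq> 0" "{B \<in> carrier (GL n). p B \<noteq> 0} \<subseteq> a" by auto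
  from Int.IH(2) Int.prems obtain q where q: "q \<in> regular_funs C n"
    "q A \<noteq> 0" "{B \<in> carrier (GL n). q B \<noteq> 0} \<subseteq> b" by auto
  have "(\<lambda>A. p A * q A) \<in> regular_funs C n" using p q by (intro regular_funs.mult)
  with p q show ?case by (intro conjI bexI[of _ "\<lambda>A. p A * q A"]) auto
next
  case (UN \<V>)
  then obtain W where W: "W \<in> \<V>" "A \<in> W" by auto
  with UN.IH[OF W] show ?case by blast
next
  case (Basis s)
  then show ?case by blast
qed auto

lemma openin_zariski_imp:
  assumes "openin (zariski C n) V"
  shows "\<exists>P\<subseteq>regular_funs C n. V = {A \<in> carrier (GL n). \<exists>p\<in>P. p A \<noteq> 0}"
proof (intro exI conjI)
  let ?P = "{p \<in> regular_funs C n. {B \<in> carrier (GL n). p B \<noteq> 0} \<subseteq> V}"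
  show "?P \<subseteq> regular_funs C n" by auto
  show "V = {A \<in> carrier (GL n). \<exists>p\<in>?P. p A \<noteq> 0}"
    using openin_zariski_principal[OF assms] by auto
qed

lemma closedin_zariski:
  "closedin (zariski UNIV n) V \<longleftrightarrow>
     (\<exists>P\<subseteq>regular_funs UNIV n. V = {A \<in> carrier (GL n). \<forall>p\<in>P. p A = 0})"
proof
  assume V: "closedin (zariski UNIV n) V"
  then have "V \<subseteq> carrier (GL n)" "openin (zariski UNIV n) (carrier (GL n) - V)"
    by (simp_all add: closedin_def topspace_zariski)
  moreover from openin_zariski_imp[OF this(2)] obtain P where "P \<subseteq> regular_funs UNIV n"
    "carrier (GL n) - V = {A \<in> carrier (GL n). \<exists>p\<in>P. p A \<noteq> 0}" by blast
  ultimately show "\<exists>P\<subseteq>regular_funs UNIV n. V = {A \<in> carrier (GL n). \<forall>p\<in>P. p A = 0}"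
    by (intro exI[of _ P]) blast
next
  assume "\<exists>P\<subseteq>regular_funs UNIV n. V = {A \<in> carrier (GL n). \<forall>p\<in>P. p A = 0}"
  then obtain P where P: "P \<subseteq> regular_funs UNIV n" "V = {A \<in> carrier (GL n). \<forall>p\<in>P. p A = 0}"
    by blast
  have "carrier (GL n) - V = (\<Union>p\<in>P. {A \<in> carrier (GL n). p A \<noteq> 0})" using P by auto
  also have "openin (zariski UNIV n) \<dots>" using P by (intro openin_Union) (auto intro: openin_principal)
  finally show "closedin (zariski UNIV n) V"
    using P by (auto simp: closedin_def topspace_zariski)
qed

text \<open>The equation is linear in the entries of \<open>A\<close>. With identity matrices in
  suitable places it covers both centralizers and the fibres of a commutator map.\<close>

lemma closedin_zariski_bimult_eq:
  assumes "a \<in> carrier_mat n n" "b \<in> carrier_mat n n" "c \<in> carrier_mat n n" "d \<in> carrier_mat n n"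
  shows "closedin (zariski UNIV n) {A \<in> carrier (GL n). a * A * b = c * A * d}"
proof -
  have "\<exists>p\<in>regular_funs UNIV n. \<forall>A\<in>carrier_mat n n.
      p A = (a * A * b) $$ (i, j) - (c * A * d) $$ (i, j)" if "i < n" "j < n" for i j
  proof -
    from regular_funs_bimult[OF assms(1,2) that] obtain p where
      "p \<in> regular_funs UNIV n" "\<forall>A\<in>carrier_mat n n. (a * A * b) $$ (i, j) = p A" by blast
    moreover from regular_funs_bimult[OF assms(3,4) that] obtain q where
      "q \<in> regular_funs UNIV n" "\<forall>A\<in>carrier_mat n n. (c * A * d) $$ (i, j) = q A" by blast
    ultimately show ?thesis by (intro bexI[of _ "\<lambda>A. p A - q A"] regular_funs_diff) auto
  qed
  then obtain p where p: "\<And>i j. i < n \<Longrightarrow> j < n \<Longrightarrow> p i j \<in> regular_funs UNIV n"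
    "\<And>i j A. i < n \<Longrightarrow> j < n \<Longrightarrow> A \<in> carrier_mat n n \<Longrightarrow>
       p i j A = (a * A * b) $$ (i, j) - (c * A * d) $$ (i, j)" by metis
  have "a * A * b = c * A * d \<longleftrightarrow> (\<forall>q\<in>{p i j |i j. i < n \<and> j < n}. q A = 0)"
    if "A \<in> carrier_mat n n" for A
  proof -
    have "a * A * b = c * A * d" if "\<forall>i<n. \<forall>j<n. (a * A * b) $$ (i, j) = (c * A * d) $$ (i, j)"
      by (rule eq_matI) (use assms \<open>A \<in> carrier_mat n n\<close> that in \<open>simp_all del: index_mult_mat(1)\<close>)
    then have "a * A * b = c * A * d \<longleftrightarrow> (\<forall>i<n. \<forall>j<n. p i j A = 0)"
      using p(2)[OF _ _ that] by auto
    then show ?thesis by blast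
  qed
  then have "{A \<in> carrier (GL n). a * A * b = c * A * d} =
      {A \<in> carrier (GL n). \<forall>q\<in>{p i j |i j. i < n \<and> j < n}. q A = 0}"
    using GL_carrier_mat by blast
  then show ?thesis unfolding closedin_zariski using p(1)
    by (intro exI[of _ "{p i j |i j. i < n \<and> j < n}"]) auto
qed

lemma regular_funs_left_mult:
  assumes "p \<in> regular_funs UNIV n" "a \<in> carrier_mat n n"
  shows "\<exists>q\<in>regular_funs UNIV n. \<forall>A\<in>carrier_mat n n. q A = p (a * A)"
  using assms(1)
proof induction
  case (const c)
  then show ?case by (intro bexI[of _ "\<lambda>_. c"]) (auto intro: regular_funs.const)
next
  case (entry i j)
  from regular_funs_bimult[OF assms(2) one_carrier_mat entry] obtain p where
    "p \<in> regular_funs UNIV n" "\<forall>A\<in>carrier_mat n n. (a * A * 1\<^sub>m n) $$ (i, j) = p A" by blast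
  then show ?case using assms(2) by (intro bexI[of _ p] ballI) auto
next
  case inv_det
  \<comment> \<open>Multiplicativity of the determinant; the convention \<open>inverse 0 = 0\<close>
    makes the identity hold for singular matrices too.\<close>
  show ?case using assms(2)
    by (intro bexI[of _ "\<lambda>A. inverse (det a) * inverse (det A)"])
      (auto intro!: regular_funs.mult regular_funs.inv_det regular_funs.const simp: det_mult)
next
  case (add p q)
  then obtain p' q' where "p' \<in> regular_funs UNIV n" "\<forall>A\<in>carrier_mat n n. p' A = p (a * A)"
    "q' \<in> regular_funs UNIV n" "\<forall>A\<in>carrier_mat n n. q' A = q (a * A)" by blast
  then show ?case by (intro bexI[of _ "\<lambda>A. p' A + q' A"]) (auto intro: regular_funs.add)
next
  case (mult p q)
  then obtain p' q' where "p' \<in> regular_funs UNIV n" "\<forall>A\<in>carrier_mat n n. p' A = p (a * A)"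
    "q' \<in> regular_funs UNIV n" "\<forall>A\<in>carrier_mat n n. q' A = q (a * A)" by blast
  then show ?case by (intro bexI[of _ "\<lambda>A. p' A * q' A"]) (auto intro: regular_funs.mult)
qed

lemma closedin_zariski_left_mult:
  assumes a: "a \<in> carrier (GL n)" and V: "closedin (zariski UNIV n) V"
  shows "closedin (zariski UNIV n) {A \<in> carrier (GL n). a * A \<in> V}"
proof -
  interpret group "GL n" by (rule group_GL)
  obtain P where P: "P \<subseteq> regular_funs UNIV n" "V = {A \<in> carrier (GL n). \<forall>p\<in>P. p A = 0}"
    using V unfolding closedin_zariski by blast
  have "\<forall>p\<in>P. \<exists>q. q \<in> regular_funs UNIV n \<and> (\<forall>A\<in>carrier_mat n n. q A = p (a * A))"
    using regular_funs_left_mult[OF _ GL_carrier_mat[OF a]] P(1) by blast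
  then obtain q where q: "\<And>p. p \<in> P \<Longrightarrow> q p \<in> regular_funs UNIV n"
    "\<And>p A. p \<in> P \<Longrightarrow> A \<in> carrier_mat n n \<Longrightarrow> q p A = p (a * A)" by metis
  have "a * A \<in> V \<longleftrightarrow> (\<forall>p\<in>q ` P. p A = 0)" if "A \<in> carrier (GL n)" for A
    using m_closed[OF a that] GL_carrier_mat[OF that] q(2) P(2) by auto
  then show ?thesis unfolding closedin_zariski using q(1)
    by (intro exI[of _ "q ` P"]) auto
qed

section \<open>Noetherianity and compactness of the Zariski topology\<close>

lemma noetherian_superring_regular_funs:
  "\<exists>R. subring_of R \<and> noetherian R \<and> regular_funs (UNIV :: 'a::field set) n \<subseteq> R"
proof -
  \<comment> \<open>The constants are a field inside the ring of functions; adjoining the matrix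
    entries and 1/det one at a time reaches every regular function. A superring is enough, since
    generators are always chosen from the given set of functions.\<close>
  let ?C = "range (\<lambda>c::'a. \<lambda>_::'a mat. c)"
  have C_iff: "f \<in> ?C \<longleftrightarrow> (\<exists>c. \<forall>A. f A = c)" for f
    unfolding image_iff fun_eq_iff by simp
  have C: "subring_of ?C" unfolding subring_of_def C_iff by auto
  have "\<exists>g\<in>?C. g * f = 1" if "f \<in> ?C" "f \<noteq> 0" for f
  proof -
    from that(1) obtain c where c: "f = (\<lambda>_. c)" by auto
    with that(2) have "c \<noteq> 0" by (auto simp: zero_fun_def)
    with c show ?thesis
      by (intro bexI[of _ "\<lambda>_. inverse c"]) (auto simp: times_fun_def one_fun_def)
  qed
  then have "noetherian ?C" using C by (intro noetherian_field) auto
  moreover have "finite (insert (\<lambda>A::'a mat. inverse (det A))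
      ((\<lambda>(i, j) A. A $$ (i, j)) ` ({..<n} \<times> {..<n})))" by auto
  ultimately obtain R where R: "subring_of R" "noetherian R" "?C \<subseteq> R"
    "insert (\<lambda>A::'a mat. inverse (det A)) ((\<lambda>(i, j) A. A $$ (i, j)) ` ({..<n} \<times> {..<n})) \<subseteq> R"
    using noetherian_adjoin_finite[OF C] by metis
  have "p \<in> R" if "p \<in> regular_funs UNIV n" for p
    using that
  proof induction
    case (add p q)
    then have "p + q \<in> R" using R(1) unfolding subring_of_def by blast
    then show ?case by (simp add: plus_fun_def)
  next
    case (mult p q)
    then have "p * q \<in> R" using R(1) unfolding subring_of_def by blast
    then show ?case by (simp add: times_fun_def)
  qed (use R in auto)
  then show ?thesis using R by blast
qed

text \<open>The functions whose principal open set lies in some member of the cover are spanned by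
  finitely many of them, and where these vanish all the others vanish too. So the members chosen for
  these finitely many functions already cover \<open>V\<close>.\<close>

lemma compactin_zariski:
  fixes V :: "'a::field mat set"
  assumes "V \<subseteq> carrier (GL n)"
  shows "compactin (zariski UNIV n) V"
  unfolding compactin_def
proof (intro conjI allI impI)
  show "V \<subseteq> topspace (zariski UNIV n)" using assms by (simp add: topspace_zariski)
  fix \<U> assume \<U>: "(\<forall>U\<in>\<U>. openin (zariski UNIV n) U) \<and> V \<subseteq> \<Union>\<U>"
  let ?D = "\<lambda>p. {A \<in> carrier (GL n). p A \<noteq> 0}"
  define P where "P = {p \<in> regular_funs UNIV n. \<exists>U\<in>\<U>. ?D p \<subseteq> U}"
  obtain R :: "('a mat \<Rightarrow> 'a) set"
    where R: "subring_of R" "noetherian R" "regular_funs UNIV n \<subseteq> R"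
    using noetherian_superring_regular_funs by blast
  have "P \<subseteq> R" using R(3) by (auto simp: P_def)
  then obtain F where F: "F \<subseteq> P" "finite F" "P \<subseteq> ideal_span R F"
    using R(2) unfolding noetherian_def by meson
  have vanish: "p A = 0" if "p \<in> ideal_span R F" "\<forall>f\<in>F. f A = 0" for p A
    using that by induction auto
  have "\<forall>p\<in>F. \<exists>U. U \<in> \<U> \<and> ?D p \<subseteq> U" using F(1) by (auto simp: P_def)
  from bchoice[OF this] obtain U where U: "\<And>p. p \<in> F \<Longrightarrow> U p \<in> \<U> \<and> ?D p \<subseteq> U p" by auto
  have "V \<subseteq> \<Union>(U ` F)"
  proof
    fix A assume A: "A \<in> V"
    with \<U> obtain W where W: "W \<in> \<U>" "A \<in> W" by auto
    with \<U> have "openin (zariski UNIV n) W" by blast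
    from openin_zariski_imp[OF this] obtain Q where
      Q: "Q \<subseteq> regular_funs UNIV n" "W = {A \<in> carrier (GL n). \<exists>p\<in>Q. p A \<noteq> 0}" by blast
    with W obtain p where p: "p \<in> Q" "p A \<noteq> 0" by auto
    have "?D p \<subseteq> W" using p(1) unfolding Q(2) by blast
    then have "p \<in> ideal_span R F" using F(3) p(1) Q(1) W(1) by (auto simp: P_def)
    from vanish[OF this, of A] p(2) obtain f where "f \<in> F" "f A \<noteq> 0" by auto
    then show "A \<in> \<Union>(U ` F)" using U[of f] A assms by (intro UN_I[of f]) auto
  qed
  then show "\<exists>\<F>. finite \<F> \<and> \<F> \<subseteq> \<U> \<and> V \<subseteq> \<Union>\<F>"
    using U F(2) by (intro exI[of _ "U ` F"]) auto
qed

section \<open>Connected sets and identity components\<close>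

lemma connectedin_finite_closed_cover:
  assumes "connectedin T V" "finite K" "\<And>k. k \<in> K \<Longrightarrow> closedin T (C k)"
    and "V \<subseteq> (\<Union>k\<in>K. C k)" "\<And>k l. k \<in> K \<Longrightarrow> l \<in> K \<Longrightarrow> k \<noteq> l \<Longrightarrow> V \<inter> C k \<inter> C l = {}"
    and "k \<in> K" "x \<in> V" "x \<in> C k"
  shows "V \<subseteq> C k"
proof (rule ccontr)
  assume "\<not> V \<subseteq> C k"
  \<comment> \<open>Finiteness of \<open>K\<close> makes the union of the other pieces closed, so it
    and \<open>C k\<close> would disconnect \<open>V\<close>.\<close>
  let ?E = "\<Union>l\<in>K - {k}. C l"
  have "closedin T (C k)" "closedin T ?E"
    using assms(2,3,6) by (auto intro!: closedin_Union)
  moreover have "V \<subseteq> C k \<union> ?E" using assms(4) by blast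
  moreover have "C k \<inter> ?E \<inter> V = {}" using assms(5,6) by blast
  moreover have "C k \<inter> V \<noteq> {}" "?E \<inter> V \<noteq> {}"
    using assms(4,7,8) \<open>\<not> V \<subseteq> C k\<close> by blast+
  ultimately show False using assms(1) unfolding connectedin_closedin by blast
qed

text \<open>The commutator with \<open>c\<close> takes finitely many values on a connected set, hence is constant.\<close>

lemma connected_finite_commutators:
  assumes V: "connectedin (zariski UNIV n) V" "1\<^sub>m n \<in> V"
    and c: "c \<in> carrier (GL n)" and K: "finite K" "K \<subseteq> carrier (GL n)"
    and comm: "\<And>x. x \<in> V \<Longrightarrow> \<exists>k\<in>K. c * x = k * (x * c)"
    and x: "x \<in> V"
  shows "c * x = x * c"
proof -
  interpret group "GL n" by (rule group_GL)
  have VG: "V \<subseteq> carrier (GL n)"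
    using connectedin_subset_topspace[OF V(1)] by (simp add: topspace_zariski)
  \<comment> \<open>The fibre over \<open>k\<close> of the commutator map x \<mapsto> c x c^-1 x^-1,
    with the inverses cleared so that the equation is linear.\<close>
  let ?C = "\<lambda>k. {A \<in> carrier (GL n). c * A * 1\<^sub>m n = k * A * c}"
  have C: "A \<in> ?C k \<longleftrightarrow> c * A = k * (A * c)" if "A \<in> V" "k \<in> K" for A k
    using that VG K c m_assoc[of k A c] r_one[of "c * A"] m_closed[of c A] by (simp add: subset_iff)
  \<comment> \<open>The fibre through the identity is the one over 1, and it has to contain all of
    \<open>V\<close>.\<close>
  obtain k where k: "k \<in> K" "c * 1\<^sub>m n = k * (1\<^sub>m n * c)" using comm V(2) by blast
  then have k1: "k = 1\<^sub>m n"
    using l_one[OF c] r_one[OF c] K c right_cancel[of c "1\<^sub>m n" k] one_closed by auto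
  have "V \<subseteq> ?C k"
  proof (rule connectedin_finite_closed_cover[where C = ?C, OF V(1) K(1)])
    show "closedin (zariski UNIV n) (?C k)" if "k \<in> K" for k
      using that K c by (intro closedin_zariski_bimult_eq) (auto intro: GL_carrier_mat)
    show "V \<subseteq> (\<Union>k\<in>K. ?C k)"
    proof
      fix A assume A: "A \<in> V"
      with comm obtain k where "k \<in> K" "c * A = k * (A * c)" by blast
      with C[OF A] show "A \<in> (\<Union>k\<in>K. ?C k)" by (intro UN_I[of k]) auto
    qed
    show "V \<inter> ?C k \<inter> ?C l = {}" if "k \<in> K" "l \<in> K" "k \<noteq> l" for k l
    proof (rule ccontr)
      assume "V \<inter> ?C k \<inter> ?C l \<noteq> {}"
      then obtain A where A: "A \<in> V" "A \<in> ?C k" "A \<in> ?C l" by (metis (no_types, lifting) IntE ex_in_conv)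
      then have "k * (A * c) = l * (A * c)" using C[OF A(1) that(1)] C[OF A(1) that(2)] by simp
      moreover have "A * c \<in> carrier (GL n)" using A VG c m_closed[of A c] by auto
      ultimately show False using right_cancel[of "A * c" k l] that K by auto
    qed
    show "1\<^sub>m n \<in> ?C k" using C[OF V(2) k(1)] k(2) by simp
  qed (use k V in auto)
  then have "c * x = k * (x * c)" using x C k by blast
  then show ?thesis using k1 l_one[of "x * c"] m_closed[of x c] x VG c by auto
qed

text \<open>The proof shows that the connected component of the identity, here the intersection of all
  relatively clopen subsets containing it, is relatively open, by compactness of its complement.\<close>

lemma finite_if_connected_subgroups_trivial:
  assumes A: "alg_group UNIV n A"
    and triv: "\<And>N. N \<subseteq> A \<Longrightarrow> alg_group UNIV n N \<Longrightarrow> connected_group n N \<Longrightarrow> N = {1\<^sub>m n}"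
  shows "finite A"
proof -
  interpret group "GL n" by (rule group_GL)
  let ?T = "zariski UNIV n"
  have sub: "subgroup A (GL n)" and clA: "closedin ?T A" using A by (auto simp: alg_group_def)
  interpret A: subgroup A "GL n" by (rule sub)
  have AG: "x \<in> carrier (GL n)" if "x \<in> A" for x using A.subset that by auto
  have oneA: "1\<^sub>m n \<in> A" using A.one_closed by simp
  have mulA: "x * y \<in> A" if "x \<in> A" "y \<in> A" for x y using A.m_closed that by simp
  have invA: "inv\<^bsub>GL n\<^esub> x \<in> A" if "x \<in> A" for x using A.m_inv_closed that by simp
  \<comment> \<open>As \<open>A\<close> is closed, relatively closed subsets of \<open>A\<close> are
    closed in the ambient topology, and clopen can be expressed by \<open>closedin\<close>
    alone.\<close>
  define clop where "clop = {U. U \<subseteq> A \<and> closedin ?T U \<and> closedin ?T (A - U)}"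
  have tr: "{x \<in> A. a * x \<in> U} \<in> clop" if "U \<in> clop" "a \<in> A" for U a
  proof -
    have "closedin ?T {x \<in> A. a * x \<in> W}" if "closedin ?T W" for W
    proof -
      have "{x \<in> A. a * x \<in> W} = A \<inter> {x \<in> carrier (GL n). a * x \<in> W}" using AG by auto
      then show ?thesis
        using closedin_zariski_left_mult[OF AG[OF \<open>a \<in> A\<close>] that] clA by auto
    qed
    moreover have "A - {x \<in> A. a * x \<in> U} = {x \<in> A. a * x \<in> A - U}" using mulA that by blast
    ultimately have "closedin ?T (A - {x \<in> A. a * x \<in> U})" "closedin ?T {x \<in> A. a * x \<in> U}"
      using that(1) unfolding clop_def by (simp_all only: mem_Collect_eq)
    then show ?thesis unfolding clop_def by blast
  qed
  define B where "B = \<Inter>{U \<in> clop. 1\<^sub>m n \<in> U}"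
  have A_clop: "A \<in> clop" using clA by (simp add: clop_def)
  have BA: "B \<subseteq> A" and B1: "1\<^sub>m n \<in> B" using A_clop oneA by (auto simp: B_def)
  have B_clop: "B \<in> clop"
  proof -
    let ?c = "\<lambda>U. carrier (GL n) - U"
    have "A - B \<subseteq> \<Union>(?c ` {U \<in> clop. 1\<^sub>m n \<in> U})" using AG by (auto simp: B_def)
    moreover have "\<forall>U\<in>?c ` {U \<in> clop. 1\<^sub>m n \<in> U}. openin ?T U"
      by (auto simp: clop_def closedin_def topspace_zariski)
    moreover have "compactin ?T (A - B)" using AG by (intro compactin_zariski) auto
    ultimately obtain \<F> where \<F>: "finite \<F>" "\<F> \<subseteq> ?c ` {U \<in> clop. 1\<^sub>m n \<in> U}" "A - B \<subseteq> \<Union>\<F>"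
      unfolding compactin_def by meson
    from finite_subset_image[OF \<F>(1,2)] obtain \<G> where
      \<G>: "finite \<G>" "\<G> \<subseteq> {U \<in> clop. 1\<^sub>m n \<in> U}" "\<F> = ?c ` \<G>" by auto
    have "A - B = (\<Union>U\<in>\<G>. A - U)" using \<F>(3) \<G> by (auto simp: B_def)
    also have "closedin ?T \<dots>" using \<G> by (intro closedin_Union) (auto simp: clop_def)
    finally have "closedin ?T (A - B)" .
    moreover have "closedin ?T B" unfolding B_def using A_clop oneA
      by (intro closedin_Inter) (auto simp: clop_def intro!: exI[of _ A])
    ultimately show ?thesis using BA by (simp add: clop_def)
  qed
  have B_least: "B \<subseteq> U" if "U \<in> clop" "1\<^sub>m n \<in> U" for U using that by (auto simp: B_def)
  have "connectedin ?T B"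
    unfolding connectedin_closedin
  proof (intro conjI notI)
    show "B \<subseteq> topspace ?T" using BA AG by (auto simp: topspace_zariski)
    \<comment> \<open>Since \<open>B\<close> is clopen in \<open>A\<close>, each half of a
      separation of \<open>B\<close> is clopen in \<open>A\<close> as well; minimality of
      \<open>B\<close> then puts it inside the half containing the identity.\<close>
    have part: "B \<subseteq> E1" if E: "closedin ?T E1" "closedin ?T E2" "B \<subseteq> E1 \<union> E2" "E1 \<inter> E2 \<inter> B = {}"
      "1\<^sub>m n \<in> E1" for E1 E2
    proof -
      have "A - (B \<inter> E1) = (A - B) \<union> (B \<inter> E2)" using E(3,4) BA by blast
      moreover have "closedin ?T \<dots>" using E B_clop by (auto simp: clop_def)
      ultimately have "closedin ?T (A - (B \<inter> E1))" by simp
      moreover have "closedin ?T (B \<inter> E1)" using E B_clop by (auto simp: clop_def)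
      ultimately have "B \<inter> E1 \<in> clop" using BA by (auto simp: clop_def)
      then show ?thesis using B_least[of "B \<inter> E1"] B1 E(5) by auto
    qed
    assume "\<exists>E1 E2. closedin ?T E1 \<and> closedin ?T E2 \<and> B \<subseteq> E1 \<union> E2 \<and> E1 \<inter> E2 \<inter> B = {} \<and>
      E1 \<inter> B \<noteq> {} \<and> E2 \<inter> B \<noteq> {}"
    then obtain E1 E2 where E: "closedin ?T E1" "closedin ?T E2" "B \<subseteq> E1 \<union> E2"
      "E1 \<inter> E2 \<inter> B = {}" "E1 \<inter> B \<noteq> {}" "E2 \<inter> B \<noteq> {}" by blast
    show False
    proof (cases "1\<^sub>m n \<in> E1")
      case True
      from part[OF E(1-4) this] E show False by blast
    next
      case False
      then have "1\<^sub>m n \<in> E2" using E(3) B1 by blast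
      with part[of E2 E1] E show False by blast
    qed
  qed
  moreover have "subgroup B (GL n)"
  proof (rule subgroupI)
    show "B \<subseteq> carrier (GL n)" using BA AG by blast
    show "B \<noteq> {}" using B1 by blast
  next
    fix b assume b: "b \<in> B"
    then have bA: "b \<in> A" using BA by blast
    let ?b = "inv\<^bsub>GL n\<^esub> b"
    have b1: "?b * b = 1\<^sub>m n" "?b * 1\<^sub>m n = ?b"
      using l_inv[OF AG[OF bA]] r_one[OF AG[OF invA[OF bA]]] by simp_all
    \<comment> \<open>Closure under inverses from translations only: \<open>?W\<close> is the
      translate b B, a clopen set containing \<open>b\<close>. If it missed the identity, its
      complement would be a clopen set around the identity, hence would contain \<open>B\<close> and
      with it \<open>b\<close>.\<close>
    let ?W = "{x \<in> A. ?b * x \<in> B}"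
    have "?W \<in> clop" using tr[OF B_clop invA[OF bA]] .
    then have "A - ?W \<in> clop" unfolding clop_def using clA by (auto simp: double_diff)
    moreover have "b \<notin> A - ?W" using bA b1(1) B1 by simp
    ultimately have "1\<^sub>m n \<notin> A - ?W" using B_least[of "A - ?W"] b by blast
    then show "?b \<in> B" using b1(2) oneA by simp
  next
    fix b x assume b: "b \<in> B" "x \<in> B"
    then have bA: "b \<in> A" using BA by blast
    have "b * 1\<^sub>m n = b" using r_one[OF AG[OF bA]] by simp
    \<comment> \<open>The right-hand side is the clopen translate b^-1 B, which contains the
      identity because \<open>b\<close> is in \<open>B\<close>.\<close>
    then have "B \<subseteq> {x \<in> A. b * x \<in> B}" using b oneA by (intro B_least tr[OF B_clop bA]) auto
    then show "b \<otimes>\<^bsub>GL n\<^esub> x \<in> B" using b by auto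
  qed
  ultimately have B_triv: "B = {1\<^sub>m n}"
    using B_clop BA by (intro triv) (auto simp: alg_group_def connected_group_def clop_def)
  \<comment> \<open>Singletons are translates of the clopen set \<open>B\<close>, so
    \<open>A\<close> is discrete. The open sets used below meet \<open>A\<close> in single points,
    and compactness leaves finitely many of them.\<close>
  have "A - {a} \<in> clop" if a: "a \<in> A" for a
  proof -
    let ?a = "inv\<^bsub>GL n\<^esub> a"
    have "?a * x = 1\<^sub>m n \<longleftrightarrow> x = a" if "x \<in> A" for x
      using l_inv[OF AG[OF a]] AG[OF a] AG[OF that] inv_equality[of ?a x] inv_inv[of a] invA[OF a] AG
      by auto
    then have "{x \<in> A. ?a * x \<in> {1\<^sub>m n}} = {a}" using a by auto
    then have "{a} \<in> clop" using tr[of "{1\<^sub>m n}" ?a] B_clop B_triv invA[OF a] by simp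
    then show ?thesis using clA a by (auto simp: clop_def double_diff)
  qed
  then have "\<forall>U\<in>(\<lambda>a. carrier (GL n) - (A - {a})) ` A. openin ?T U"
    by (auto simp: clop_def closedin_def topspace_zariski)
  moreover have "A \<subseteq> \<Union>((\<lambda>a. carrier (GL n) - (A - {a})) ` A)" using AG by auto
  moreover have "compactin ?T A" using AG by (intro compactin_zariski) auto
  ultimately obtain \<F> where \<F>: "finite \<F>" "\<F> \<subseteq> (\<lambda>a. carrier (GL n) - (A - {a})) ` A" "A \<subseteq> \<Union>\<F>"
    unfolding compactin_def by meson
  from finite_subset_image[OF \<F>(1,2)] obtain F where
    "finite F" "\<F> = (\<lambda>a. carrier (GL n) - (A - {a})) ` F" by auto
  with \<F>(3) have "A \<subseteq> F" by blast
  with \<open>finite F\<close> show ?thesis by (rule rev_finite_subset)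
qed

section \<open>Centers and coverings\<close>

text \<open>Conjugating the assumed relation by \<open>x\<close> gives the conclusion. In
  \<open>rho_center\<close> it shows that the conjugates of an element centralizing a normal
  subgroup still centralize it.\<close>

lemma (in group) conj_commutes:
  assumes "x \<in> carrier G" "t \<in> carrier G" "d \<in> carrier G"
    and "t \<otimes> (inv x \<otimes> d \<otimes> x) = (inv x \<otimes> d \<otimes> x) \<otimes> t"
  shows "(x \<otimes> t \<otimes> inv x) \<otimes> d = d \<otimes> (x \<otimes> t \<otimes> inv x)"
proof -
  have cancel: "x \<otimes> (inv x \<otimes> w) = w" if "w \<in> carrier G" for w
    using assms(1) that by (simp add: m_assoc[symmetric])
  have "(x \<otimes> t \<otimes> inv x) \<otimes> d = x \<otimes> (t \<otimes> (inv x \<otimes> d \<otimes> x)) \<otimes> inv x"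
    using assms(1-3) by (simp add: m_assoc)
  also have "\<dots> = x \<otimes> ((inv x \<otimes> d \<otimes> x) \<otimes> t) \<otimes> inv x" by (simp only: assms(4))
  also have "\<dots> = (x \<otimes> inv x) \<otimes> d \<otimes> (x \<otimes> t \<otimes> inv x)"
    using assms(1-3) by (simp add: m_assoc cancel)
  also have "\<dots> = d \<otimes> (x \<otimes> t \<otimes> inv x)" using assms(1-3) by simp
  finally show ?thesis .
qed

lemma (in group) subgroup_center: "subgroup (center G) G"
proof (rule subgroupI)
  show "center G \<subseteq> carrier G" by (auto simp: center_def)
  have "\<one> \<in> center G" by (simp add: center_def)
  then show "center G \<noteq> {}" by blast
next
  fix a assume a: "a \<in> center G"
  then have aG: "a \<in> carrier G" by (simp add: center_def)
  have "inv a \<otimes> x = x \<otimes> inv a" if x: "x \<in> carrier G" for x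
  proof -
    have "inv a \<otimes> x = inv a \<otimes> (x \<otimes> a) \<otimes> inv a" using aG x by (simp add: m_assoc)
    also have "x \<otimes> a = a \<otimes> x" using a x by (simp add: center_def)
    also have "inv a \<otimes> (a \<otimes> x) = x" using aG x by (simp add: m_assoc[symmetric])
    finally show ?thesis .
  qed
  with aG show "inv a \<in> center G" by (simp add: center_def)
next
  fix a b assume "a \<in> center G" "b \<in> center G"
  then have *: "a \<in> carrier G" "b \<in> carrier G"
    "\<And>x. x \<in> carrier G \<Longrightarrow> a \<otimes> x = x \<otimes> a" "\<And>x. x \<in> carrier G \<Longrightarrow> b \<otimes> x = x \<otimes> b"
    by (auto simp: center_def)
  have "a \<otimes> b \<otimes> x = x \<otimes> (a \<otimes> b)" if x: "x \<in> carrier G" for x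
  proof -
    have "a \<otimes> b \<otimes> x = a \<otimes> (b \<otimes> x)" using *(1,2) x by (rule m_assoc)
    also have "\<dots> = a \<otimes> (x \<otimes> b)" by (simp only: *(4)[OF x])
    also have "\<dots> = (a \<otimes> x) \<otimes> b" using *(1,2) x by (simp add: m_assoc)
    also have "\<dots> = (x \<otimes> a) \<otimes> b" by (simp only: *(3)[OF x])
    also have "\<dots> = x \<otimes> (a \<otimes> b)" using *(1,2) x by (simp add: m_assoc)
    finally show ?thesis .
  qed
  with *(1,2) show "a \<otimes> b \<in> center G" by (simp add: center_def)
qed

lemma center_grp: "z \<in> center (grp n H) \<longleftrightarrow> z \<in> H \<and> (\<forall>x\<in>H. z * x = x * z)"
  by (simp add: center_def)

lemma subgroup_center_GL:
  assumes "subgroup H (GL n)"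
  shows "subgroup (center (grp n H)) (GL n)"
  by (rule group.incl_subgroup[OF group_GL assms
        group.subgroup_center[OF group.subgroup_imp_group[OF group_GL assms]]])

text \<open>Within \<open>H\<close> the center is an intersection of centralizers, each cut out by
  linear equations.\<close>

lemma alg_group_center:
  assumes "alg_group UNIV n H"
  shows "alg_group UNIV n (center (grp n H))"
proof -
  have H: "subgroup H (GL n)" "closedin (zariski UNIV n) H" using assms by (auto simp: alg_group_def)
  interpret H: subgroup H "GL n" by (rule H(1))
  let ?C = "\<lambda>x. {z \<in> carrier (GL n). 1\<^sub>m n * z * x = x * z * 1\<^sub>m n}"
  have HG: "x \<in> carrier_mat n n" if "x \<in> H" for x using H.subset that GL_carrier_mat by blast
  have "center (grp n H) = H \<inter> (\<Inter>x\<in>H. ?C x)"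
  proof (rule Set.set_eqI)
    fix z
    have "z \<in> ?C x \<longleftrightarrow> z * x = x * z" if "z \<in> H" "x \<in> H" for x
      using HG[OF that(1)] HG[OF that(2)] H.subset that by auto
    then show "z \<in> center (grp n H) \<longleftrightarrow> z \<in> H \<inter> (\<Inter>x\<in>H. ?C x)"
      unfolding center_grp by auto
  qed
  moreover have "closedin (zariski UNIV n) (\<Inter>x\<in>H. ?C x)"
  proof (rule closedin_Inter)
    show "?C ` H \<noteq> {}" using H.one_closed by blast
    show "closedin (zariski UNIV n) S" if "S \<in> ?C ` H" for S
      using that HG by (auto intro!: closedin_zariski_bimult_eq)
  qed
  ultimately have "closedin (zariski UNIV n) (center (grp n H))" using H(2) by (simp add: closedin_Int)
  then show ?thesis using subgroup_center_GL[OF H(1)] by (simp add: alg_group_def)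
qed

text \<open>A closed connected subgroup of the center is abelian, hence solvable, and normal because
  it is central; semisimplicity makes it trivial.\<close>

lemma finite_center:
  assumes "connected_semisimple n H"
  shows "finite (center (grp n H))"
proof (rule finite_if_connected_subgroups_trivial)
  have alg: "alg_group UNIV n H" using assms by (simp add: connected_semisimple_def)
  then show "alg_group UNIV n (center (grp n H))" by (rule alg_group_center)
  have H: "subgroup H (GL n)" using alg by (simp add: alg_group_def)
  interpret GL: group "GL n" by (rule group_GL)
  interpret H: group "grp n H" by (rule GL.subgroup_imp_group[OF H])
  fix N assume N: "N \<subseteq> center (grp n H)" "alg_group UNIV n N" "connected_group n N"
  have N_sub: "subgroup N (GL n)" using N(2) by (simp add: alg_group_def)
  have NH: "N \<subseteq> H" using N(1) by (auto simp: center_grp)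
  interpret N: group "grp n N" by (rule GL.subgroup_imp_group[OF N_sub])
  have comm: "x * y = y * x" if "x \<in> N" "y \<in> H" for x y using that N(1) by (auto simp: center_grp)
  interpret N: comm_group "grp n N"
    by (rule N.group_comm_groupI) (use comm NH in auto)
  have "derived (grp n N) (carrier (grp n N)) = {\<one>\<^bsub>grp n N\<^esub>}"
    by (rule N.derived_eq_singleton) simp
  then have "solvable (grp n N)"
    unfolding N.solvable_iff_trivial_derived_seq by (intro exI[of _ "Suc 0"]) simp
  moreover have "N \<lhd> grp n H"
    unfolding H.normal_inv_iff
  proof (intro conjI ballI)
    show "subgroup N (grp n H)" by (rule GL.subgroup_incl[OF N_sub H NH])
    fix x h assume xh: "x \<in> carrier (grp n H)" "h \<in> N"
    then have hH: "h \<in> carrier (grp n H)" using NH by auto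
    have "x \<otimes>\<^bsub>grp n H\<^esub> h \<otimes>\<^bsub>grp n H\<^esub> inv\<^bsub>grp n H\<^esub> x = h \<otimes>\<^bsub>grp n H\<^esub> x \<otimes>\<^bsub>grp n H\<^esub> inv\<^bsub>grp n H\<^esub> x"
      using comm[of h x] xh by simp
    also have "\<dots> = h" using H.m_assoc[OF hH xh(1) H.inv_closed[OF xh(1)]] H.r_inv[OF xh(1)]
        H.r_one[OF hH] by simp
    finally show "x \<otimes>\<^bsub>grp n H\<^esub> h \<otimes>\<^bsub>grp n H\<^esub> inv\<^bsub>grp n H\<^esub> x \<in> N" using xh by simp
  qed
  ultimately have "alg_group UNIV n N \<and> connected_group n N \<and> N \<lhd> grp n H \<and> solvable (grp n N)"
    using N by blast
  with assms[unfolded connected_semisimple_def] show "N = {1\<^sub>m n}" by metis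
qed

section \<open>The covering homomorphism and the two centers\<close>

locale reductive_covering =
  fixes n m :: nat and G Gsc :: "'k::field alg_closure mat set"
    and \<rho> :: "'k alg_closure mat \<Rightarrow> 'k alg_closure mat"
  assumes G_alg: "alg_group base_field n G"
    and G_reductive: "connected_reductive n G"
    and covering: "universal_covering n G m Gsc \<rho>"
begin

abbreviation "Gss \<equiv> derived (GL n) G"

sublocale GLn: group "GL n :: 'k alg_closure mat monoid" by (rule group_GL)
sublocale GLm: group "GL m :: 'k alg_closure mat monoid" by (rule group_GL)

lemma G_subgroup: "subgroup G (GL n)" using G_alg by (simp add: alg_group_def)

lemma Gsc_alg: "alg_group base_field m Gsc" using covering by (simp add: universal_covering_def)

lemma Gsc_subgroup: "subgroup Gsc (GL m)" using Gsc_alg by (simp add: alg_group_def)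

lemma Gsc_semisimple: "connected_semisimple m Gsc"
  using covering by (simp add: universal_covering_def simply_connected_def)

sublocale G: group "grp n G" by (rule GLn.subgroup_imp_group[OF G_subgroup])
sublocale Gsc: group "grp m Gsc" by (rule GLm.subgroup_imp_group[OF Gsc_subgroup])

lemma Gss_subset: "Gss \<subseteq> G"
  by (rule GLn.derived_incl[OF order_refl G_subgroup])

lemma rho_image: "\<rho> ` Gsc = Gss"
  using covering by (simp add: universal_covering_def isogeny_def)

lemma rho_hom_Gss: "\<rho> \<in> hom (grp m Gsc) (grp n Gss)"
  using covering by (simp add: universal_covering_def isogeny_def alg_hom_def)

lemma rho_mult: "x \<in> Gsc \<Longrightarrow> y \<in> Gsc \<Longrightarrow> \<rho> (x * y) = \<rho> x * \<rho> y"
  using rho_hom_Gss by (auto simp: hom_def)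

lemma rho_closed: "x \<in> Gsc \<Longrightarrow> \<rho> x \<in> G"
  using rho_image Gss_subset by auto

lemma rho_hom: "\<rho> \<in> hom (grp m Gsc) (grp n G)"
  by (rule homI) (auto simp: rho_closed rho_mult)

sublocale rho: group_hom "grp m Gsc" "grp n G" \<rho>
  by unfold_locales (rule rho_hom)

lemma G_carrier: "x \<in> G \<Longrightarrow> x \<in> carrier (GL n)"
  using subgroup.subset[OF G_subgroup] by blast

lemma Gsc_carrier: "x \<in> Gsc \<Longrightarrow> x \<in> carrier (GL m)"
  using subgroup.subset[OF Gsc_subgroup] by blast

lemma central_if_image_central:
  assumes c: "c \<in> Gsc" and comm: "\<And>x. x \<in> Gsc \<Longrightarrow> \<rho> c * \<rho> x = \<rho> x * \<rho> c"
  shows "c \<in> center (grp m Gsc)"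
  unfolding center_grp
proof (intro conjI ballI c)
  fix x assume x: "x \<in> Gsc"
  let ?K = "kernel (grp m Gsc) (grp n Gss) \<rho>"
  show "c * x = x * c"
  proof (rule connected_finite_commutators[where V = Gsc and K = ?K])
    show "connectedin (zariski UNIV m) Gsc"
      using Gsc_semisimple by (simp add: connected_semisimple_def connected_group_def)
    show "1\<^sub>m m \<in> Gsc" using subgroup.one_closed[OF Gsc_subgroup] by simp
    show "finite ?K" using covering by (simp add: universal_covering_def isogeny_def)
    show "?K \<subseteq> carrier (GL m)" using Gsc_carrier by (auto simp: kernel_def)
    show "c \<in> carrier (GL m)" using c by (rule Gsc_carrier)
    fix y assume y: "y \<in> Gsc"
    let ?k = "c * y \<otimes>\<^bsub>grp m Gsc\<^esub> inv\<^bsub>grp m Gsc\<^esub> (y * c)"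
    have cy: "c * y \<in> Gsc" "y * c \<in> Gsc"
      using subgroup.m_closed[OF Gsc_subgroup] c y by auto
    have k: "?k \<in> Gsc" using Gsc.m_closed[of "c * y" "inv\<^bsub>grp m Gsc\<^esub> (y * c)"]
        Gsc.inv_closed[of "y * c"] cy by simp
    have "\<rho> ?k = \<rho> (c * y) \<otimes>\<^bsub>grp n G\<^esub> inv\<^bsub>grp n G\<^esub> \<rho> (y * c)"
      using rho.hom_mult[of "c * y" "inv\<^bsub>grp m Gsc\<^esub> (y * c)"] rho.hom_inv[of "y * c"]
        Gsc.inv_closed[of "y * c"] cy by simp
    also have "\<rho> (c * y) = \<rho> (y * c)" using comm[OF y] c y by (simp add: rho_mult)
    also have "\<rho> (y * c) \<otimes>\<^bsub>grp n G\<^esub> inv\<^bsub>grp n G\<^esub> \<rho> (y * c) = 1\<^sub>m n"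
      using G.r_inv[of "\<rho> (y * c)"] rho_closed[OF cy(2)] by simp
    finally have "?k \<in> ?K" using k by (simp add: kernel_def)
    moreover have "c * y = ?k * (y * c)"
      using Gsc.m_assoc[of "c * y" "inv\<^bsub>grp m Gsc\<^esub> (y * c)" "y * c"] Gsc.l_inv[of "y * c"]
        Gsc.r_one[of "c * y"] Gsc.inv_closed[of "y * c"] cy by simp
    ultimately show "\<exists>k\<in>?K. c * y = k * (y * c)" by (intro bexI[of _ ?k])
  qed (rule x)
qed

lemma center_if_rho_center:
  assumes "c \<in> Gsc" "\<rho> c \<in> center (grp n G)"
  shows "c \<in> center (grp m Gsc)"
  using assms rho_closed by (intro central_if_image_central) (auto simp: center_grp)

text \<open>The center of the semisimple group \<open>Gsc\<close> is finite, hence so is its image \<open>T\<close>, the center of the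
  derived group.  The connected group \<open>G\<close> normalizes \<open>T\<close>, so it acts trivially on it.\<close>

lemma rho_center:
  assumes c: "c \<in> center (grp m Gsc)"
  shows "\<rho> c \<in> center (grp n G)"
proof -
  define T where "T = \<rho> ` center (grp m Gsc)"
  have cGsc: "c \<in> Gsc" using c by (simp add: center_grp)
  have finT: "finite T" unfolding T_def by (intro finite_imageI finite_center Gsc_semisimple)
  have TG: "T \<subseteq> G" using rho_closed by (auto simp: T_def center_grp)
  have Gss_normal: "Gss \<lhd> grp n G" by (rule GLn.derived_subgroup_is_normal[OF G_subgroup])
  have conj_Gss: "x * d * inv\<^bsub>GL n\<^esub> x \<in> Gss" if "x \<in> G" "d \<in> Gss" for x d
  proof -
    have "\<forall>x\<in>carrier (grp n G). \<forall>h\<in>Gss.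
        x \<otimes>\<^bsub>grp n G\<^esub> h \<otimes>\<^bsub>grp n G\<^esub> inv\<^bsub>grp n G\<^esub> x \<in> Gss"
      using Gss_normal unfolding G.normal_inv_iff by (rule conjunct2)
    from this[rule_format, of x d] that show ?thesis
      using GLn.m_inv_consistent[OF G_subgroup that(1)] by simp
  qed
  have inv_G: "inv\<^bsub>GL n\<^esub> x \<in> G" if "x \<in> G" for x
    using subgroup.m_inv_closed[OF G_subgroup that] .
  \<comment> \<open>A conjugate of \<rho>(c) stays in the normal subgroup \<open>Gss\<close>, hence
    is \<rho>(c') for some c'. It still centralizes \<open>Gss\<close>, so c' is central and the
    conjugate is in \<open>T\<close>.\<close>
  have conj_T: "x * \<rho> c * inv\<^bsub>GL n\<^esub> x \<in> T" if x: "x \<in> G" for x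
  proof -
    have "x * \<rho> c * inv\<^bsub>GL n\<^esub> x \<in> Gss"
      using conj_Gss[OF x] rho_image cGsc by blast
    then obtain c' where c': "c' \<in> Gsc" "x * \<rho> c * inv\<^bsub>GL n\<^esub> x = \<rho> c'"
      using rho_image by (metis imageE)
    have "\<rho> c' * \<rho> y = \<rho> y * \<rho> c'" if y: "y \<in> Gsc" for y
    proof -
      have "inv\<^bsub>GL n\<^esub> x * \<rho> y * x \<in> Gss"
        using conj_Gss[OF inv_G[OF x], of "\<rho> y"] rho_image y GLn.inv_inv[OF G_carrier[OF x]] by auto
      then obtain y' where y': "y' \<in> Gsc" "inv\<^bsub>GL n\<^esub> x * \<rho> y * x = \<rho> y'"
        using rho_image by (metis imageE)
      have "\<rho> c * \<rho> y' = \<rho> y' * \<rho> c"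
        using c y'(1) rho_mult[of c y'] rho_mult[of y' c] by (simp add: center_grp)
      then show ?thesis
        using GLn.conj_commutes[of x "\<rho> c" "\<rho> y"] x y cGsc rho_closed G_carrier
        by (simp add: y'(2) c'(2)[symmetric])
    qed
    then have "c' \<in> center (grp m Gsc)" using central_if_image_central c'(1) by blast
    then show ?thesis unfolding c'(2) T_def by blast
  qed
  let ?t = "\<rho> c"
  have t: "?t \<in> carrier (GL n)" using rho_closed cGsc G_carrier by blast
  \<comment> \<open>The commutator of t and y is t s^-1 with s = y t y^-1, and s ranges over the
    finite set \<open>T\<close>.\<close>
  let ?K = "(\<lambda>s. ?t * inv\<^bsub>GL n\<^esub> s) ` T"
  have "?t * x = x * ?t" if "x \<in> G" for x
  proof (rule connected_finite_commutators[where V = G and K = ?K])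
    show "connectedin (zariski UNIV n) G"
      using G_reductive by (simp add: connected_reductive_def connected_group_def)
    show "1\<^sub>m n \<in> G" using subgroup.one_closed[OF G_subgroup] by simp
    show "finite ?K" using finT by simp
    show "?K \<subseteq> carrier (GL n)"
      using GLn.m_closed[OF t GLn.inv_closed] TG G_carrier by auto
    show "?t \<in> carrier (GL n)" by (rule t)
    fix y assume y: "y \<in> G"
    let ?s = "y * ?t * inv\<^bsub>GL n\<^esub> y"
    note cl = GLn.m_closed[simplified] GLn.inv_closed
    have yc: "y \<in> carrier (GL n)" using y by (rule G_carrier)
    have s: "?s \<in> carrier (GL n)" by (intro cl yc t)
    have "?s * y = y * ?t"
      using GLn.inv_solve_right'[of "y * ?t" y ?s] cl(1)[OF yc t] yc s
        GLn.m_assoc[of "y * ?t" "inv\<^bsub>GL n\<^esub> y" y] GLn.l_inv[OF yc] GLn.r_one[of "y * ?t"] cl(2)[OF yc]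
      by simp
    then have "?t * inv\<^bsub>GL n\<^esub> ?s * (y * ?t) = ?t * (inv\<^bsub>GL n\<^esub> ?s * (?s * y))"
      using GLn.m_assoc[of ?t "inv\<^bsub>GL n\<^esub> ?s" "y * ?t"] cl(1)[OF yc t] t cl(2)[OF s] by simp
    also have "inv\<^bsub>GL n\<^esub> ?s * (?s * y) = y"
      using GLn.m_assoc[of "inv\<^bsub>GL n\<^esub> ?s" ?s y] GLn.l_inv[OF s] GLn.l_one[OF yc] s yc cl(2)[OF s] by simp
    finally have "?t * y = ?t * inv\<^bsub>GL n\<^esub> ?s * (y * ?t)" by (rule sym)
    then show "\<exists>k\<in>?K. ?t * y = k * (y * ?t)" by (rule bexI[OF _ imageI[OF conj_T[OF y]]])
  qed (rule that)
  then show ?thesis using rho_closed[OF cGsc] by (simp add: center_grp)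
qed

end

section \<open>The Galois action\<close>

lemma Gal_field_isom: "\<sigma> \<in> Gal \<Longrightarrow> field_isom \<sigma>"
  by (simp add: Gal_def)

lemma Gal_base_field: "\<sigma> \<in> Gal \<Longrightarrow> c \<in> base_field \<Longrightarrow> \<sigma> c = c"
  by (auto simp: Gal_def base_field_def)

lemma Gal_comp:
  assumes "\<sigma> \<in> Gal" "\<tau> \<in> Gal"
  shows "\<sigma> \<circ> \<tau> \<in> Gal"
proof -
  interpret s: field_isom \<sigma> using assms(1) by (rule Gal_field_isom)
  interpret t: field_isom \<tau> using assms(2) by (rule Gal_field_isom)
  have "surj (\<sigma> \<circ> \<tau>)" using t.surj s.surj by (rule comp_surj)
  then have "field_isom (\<sigma> \<circ> \<tau>)"
    by unfold_locales (auto simp: s.hom_add t.hom_add s.hom_mult t.hom_mult)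
  then show ?thesis using assms by (simp add: Gal_def)
qed

lemma map_mat_Gal_mult:
  assumes "\<sigma> \<in> Gal" "A \<in> carrier_mat n n" "B \<in> carrier_mat n n"
  shows "map_mat \<sigma> (A * B) = map_mat \<sigma> A * map_mat \<sigma> B"
proof -
  interpret field_isom \<sigma> using assms(1) by (rule Gal_field_isom)
  show ?thesis using assms(2,3) by (rule mat_hom_mult)
qed

lemma det_map_mat_Gal:
  assumes "\<sigma> \<in> Gal"
  shows "det (map_mat \<sigma> A) = \<sigma> (det A)"
proof -
  interpret field_isom \<sigma> using assms(1) by (rule Gal_field_isom)
  show ?thesis by (rule hom_det)
qed

lemma map_mat_Gal_GL:
  assumes "\<sigma> \<in> Gal"
  shows "map_mat \<sigma> A \<in> carrier (GL n) \<longleftrightarrow> A \<in> carrier (GL n)"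
proof -
  interpret field_isom \<sigma> using assms(1) by (rule Gal_field_isom)
  show ?thesis by (simp add: carrier_GL det_map_mat_Gal[OF assms])
qed

lemma regular_funs_map_mat_Gal:
  assumes "p \<in> regular_funs base_field n" "\<sigma> \<in> Gal" "A \<in> carrier_mat n n"
  shows "p (map_mat \<sigma> A) = \<sigma> (p A)"
proof -
  interpret field_isom \<sigma> using assms(2) by (rule Gal_field_isom)
  show ?thesis using assms(1)
    by induction
      (use assms in \<open>auto simp: Gal_base_field det_map_mat_Gal hom_inverse hom_add hom_mult\<close>)
qed

text \<open>Functions with coefficients in the base field commute with \<sigma>, and \<sigma> sends
  exactly 0 to 0, so the defining equations hold at a matrix iff they hold at its image.\<close>

lemma closedin_map_mat_Gal:
  fixes V :: "'k::field alg_closure mat set"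
  assumes V: "closedin (zariski base_field n) V" and \<sigma>: "\<sigma> \<in> Gal"
  shows "map_mat \<sigma> A \<in> V \<longleftrightarrow> A \<in> V"
proof -
  interpret field_isom \<sigma> using \<sigma> by (rule Gal_field_isom)
  have "1 = to_ac (1 :: 'k)" by simp
  then have "(1 :: 'k alg_closure) \<in> base_field" unfolding base_field_def by (rule range_eqI)
  then have top: "topspace (zariski (base_field :: 'k alg_closure set) n) = carrier (GL n)"
    by (rule topspace_zariski)
  have VG: "V \<subseteq> carrier (GL n)" using closedin_subset[OF V] top by simp
  have "openin (zariski base_field n) (carrier (GL n) - V)"
    using V top by (simp add: closedin_def)
  from openin_zariski_imp[OF this] obtain P where P: "P \<subseteq> regular_funs base_field n"
    "carrier (GL n) - V = {A \<in> carrier (GL n). \<exists>p\<in>P. p A \<noteq> 0}" by auto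
  show ?thesis
  proof (cases "A \<in> carrier (GL n)")
    case True
    then have A: "A \<in> carrier_mat n n" "map_mat \<sigma> A \<in> carrier (GL n)"
      using map_mat_Gal_GL[OF \<sigma>] GL_carrier_mat by auto
    have "B \<in> V \<longleftrightarrow> \<not> (\<exists>p\<in>P. p B \<noteq> 0)" if "B \<in> carrier (GL n)" for B
    proof -
      have "B \<in> carrier (GL n) - V \<longleftrightarrow> B \<in> {A \<in> carrier (GL n). \<exists>p\<in>P. p A \<noteq> 0}"
        by (simp only: P(2))
      with that show ?thesis by auto
    qed
    moreover have "p (map_mat \<sigma> A) = 0 \<longleftrightarrow> p A = 0" if "p \<in> P" for p
      using regular_funs_map_mat_Gal[of p n \<sigma> A] P(1) that \<sigma> A by auto
    ultimately show ?thesis using True A by auto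
  next
    case False
    then have "map_mat \<sigma> A \<notin> carrier (GL n)" using map_mat_Gal_GL[OF \<sigma>] by simp
    with False show ?thesis using VG by auto
  qed
qed

lemma alg_group_map_mat_Gal:
  assumes "alg_group base_field n H" "\<sigma> \<in> Gal"
  shows "map_mat \<sigma> A \<in> H \<longleftrightarrow> A \<in> H"
  using assms by (intro closedin_map_mat_Gal) (auto simp: alg_group_def)

lemma map_mat_Gal_surj:
  assumes "\<sigma> \<in> Gal"
  shows "\<exists>A. map_mat \<sigma> A = B"
proof
  interpret field_isom \<sigma> using assms by (rule Gal_field_isom)
  have "\<sigma> (inv_into UNIV \<sigma> y) = y" for y using surj by (rule surj_f_inv_f)
  then show "map_mat \<sigma> (map_mat (inv_into UNIV \<sigma>) B) = B" by (intro eq_matI) auto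
qed

lemma center_map_mat_Gal:
  assumes H: "alg_group base_field n H" and \<sigma>: "\<sigma> \<in> Gal" and z: "z \<in> center (grp n H)"
  shows "map_mat \<sigma> z \<in> center (grp n H)"
  unfolding center_grp
proof (intro conjI ballI)
  have HM: "x \<in> carrier_mat n n" if "x \<in> H" for x
    using H that subgroup.subset GL_carrier_mat unfolding alg_group_def by blast
  have zH: "z \<in> H" using z by (simp add: center_grp)
  then show "map_mat \<sigma> z \<in> H" using alg_group_map_mat_Gal[OF H \<sigma>] by simp
  fix x assume x: "x \<in> H"
  \<comment> \<open>Surjectivity matters: to commute with every \<open>x\<close> in
    \<open>H\<close>, that \<open>x\<close> must itself be the image of an element of
    \<open>H\<close>.\<close>
  obtain y where y: "map_mat \<sigma> y = x" using map_mat_Gal_surj[OF \<sigma>] by blast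
  then have yH: "y \<in> H" using alg_group_map_mat_Gal[OF H \<sigma>] x by blast
  then have "z * y = y * z" using z by (simp add: center_grp)
  then show "map_mat \<sigma> z * x = x * map_mat \<sigma> z"
    using map_mat_Gal_mult[OF \<sigma> HM[OF zH] HM[OF yH]] map_mat_Gal_mult[OF \<sigma> HM[OF yH] HM[OF zH]] y
    by simp
qed

lemma map_mat_Gal_hom:
  assumes "\<sigma> \<in> Gal" "subgroup H (GL n)" "\<And>x. x \<in> H \<Longrightarrow> map_mat \<sigma> x \<in> H"
  shows "map_mat \<sigma> \<in> hom (grp n H) (grp n H)"
proof (rule homI)
  have HM: "x \<in> carrier_mat n n" if "x \<in> H" for x
    using assms(2) that subgroup.subset GL_carrier_mat by blast
  show "map_mat \<sigma> (x \<otimes>\<^bsub>grp n H\<^esub> y) = map_mat \<sigma> x \<otimes>\<^bsub>grp n H\<^esub> map_mat \<sigma> y"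
    if "x \<in> carrier (grp n H)" "y \<in> carrier (grp n H)" for x y
    using that map_mat_Gal_mult[OF assms(1) HM HM] by simp
qed (use assms(3) in simp)

section \<open>The Krull topology and locally constant maps\<close>

lemma topspace_krull: "topspace (krull :: ('k::field alg_closure \<Rightarrow> 'k alg_closure) topology) = Gal"
proof
  show "topspace krull \<subseteq> Gal" unfolding krull_def topology_generated_by_topspace by auto
  show "Gal \<subseteq> topspace (krull :: ('k alg_closure \<Rightarrow> 'k alg_closure) topology)"
  proof
    fix \<sigma> :: "'k alg_closure \<Rightarrow> 'k alg_closure"
    assume \<sigma>: "\<sigma> \<in> Gal"
    \<comment> \<open>The empty set imposes no condition, so this basic open set is all of
      \<open>Gal\<close>.\<close>
    have "openin krull {\<tau> \<in> Gal. \<forall>x\<in>{}. \<tau> x = \<sigma> x}"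
      unfolding krull_def by (rule topology_generated_by_Basis, rule CollectI,
          intro exI[of _ \<sigma>] exI[of _ "{}"] conjI) (use \<sigma> in simp_all)
    from openin_subset[OF this] show "\<sigma> \<in> topspace krull" using \<sigma> by auto
  qed
qed

text \<open>The matrix \<open>map_mat \<sigma> A\<close> depends only on the values of \<sigma> at
  the finitely many entries of \<open>A\<close>, so the map is locally constant. The extra function
  \<open>f\<close> lets one lemma serve both \<phi> and the trivial cocycle.\<close>

lemma continuous_map_krull_map_mat:
  assumes "\<And>\<sigma>. \<sigma> \<in> Gal \<Longrightarrow> f (map_mat \<sigma> A) \<in> Y"
  shows "continuous_map krull (discrete_topology Y) (\<lambda>\<sigma>\<in>Gal. f (map_mat \<sigma> A))"
  unfolding continuous_map_def topspace_krull
proof (intro conjI allI impI)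
  let ?f = "\<lambda>\<sigma>\<in>Gal. f (map_mat \<sigma> A)"
  show "?f \<in> Gal \<rightarrow> topspace (discrete_topology Y)" using assms by simp
  fix U
  show "openin krull {\<sigma> \<in> Gal. ?f \<sigma> \<in> U}"
  proof (subst openin_subopen, intro ballI)
    fix \<sigma> assume \<sigma>: "\<sigma> \<in> {\<sigma> \<in> Gal. ?f \<sigma> \<in> U}"
    let ?S = "(\<lambda>(i, j). A $$ (i, j)) ` ({..<dim_row A} \<times> {..<dim_col A})"
    let ?T = "{\<tau> \<in> Gal. \<forall>x\<in>?S. \<tau> x = \<sigma> x}"
    have "openin krull ?T"
      unfolding krull_def
    proof (rule topology_generated_by_Basis, rule CollectI, intro exI conjI)
      show "finite ?S" by simp
    qed (use \<sigma> in auto)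
    moreover have "?T \<subseteq> {\<sigma> \<in> Gal. ?f \<sigma> \<in> U}"
    proof
      fix \<tau> assume \<tau>: "\<tau> \<in> ?T"
      then have "map_mat \<tau> A = map_mat \<sigma> A" by (intro eq_matI) auto
      with \<sigma> \<tau> show "\<tau> \<in> {\<sigma> \<in> Gal. ?f \<sigma> \<in> U}" by auto
    qed
    moreover have "\<sigma> \<in> ?T" using \<sigma> by simp
    ultimately show "\<exists>T. openin krull T \<and> \<sigma> \<in> T \<and> T \<subseteq> {\<sigma> \<in> Gal. ?f \<sigma> \<in> U}"
      by (intro exI[of _ ?T] conjI)
  qed
qed

context reductive_covering
begin

text \<open>The covering is defined over the base field: on \<open>Gsc\<close> the entries of \<rho>
  are regular functions with coefficients there, and these commute with \<sigma>.\<close>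

lemma rho_map_mat_Gal:
  assumes \<sigma>: "\<sigma> \<in> Gal" and x: "x \<in> Gsc"
  shows "\<rho> (map_mat \<sigma> x) = map_mat \<sigma> (\<rho> x)"
proof (rule eq_matI)
  have \<sigma>x: "map_mat \<sigma> x \<in> Gsc" using alg_group_map_mat_Gal[OF Gsc_alg \<sigma>] x by simp
  have xM: "x \<in> carrier_mat m m" using Gsc_carrier[OF x] by (rule GL_carrier_mat)
  have "\<rho> y \<in> carrier_mat n n" if "y \<in> Gsc" for y
    using rho_closed[OF that] G_carrier GL_carrier_mat by blast
  from this[OF x] this[OF \<sigma>x] show "dim_row (\<rho> (map_mat \<sigma> x)) = dim_row (map_mat \<sigma> (\<rho> x))"
    "dim_col (\<rho> (map_mat \<sigma> x)) = dim_col (map_mat \<sigma> (\<rho> x))" by auto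
  fix i j assume "i < dim_row (map_mat \<sigma> (\<rho> x))" "j < dim_col (map_mat \<sigma> (\<rho> x))"
  then have ij: "i < n" "j < n" "i < dim_row (\<rho> x)" "j < dim_col (\<rho> x)"
    using rho_closed[OF x] G_carrier GL_carrier_mat by auto
  have "\<forall>i<n. \<forall>j<n. \<exists>p\<in>regular_funs base_field m. \<forall>A\<in>Gsc. \<rho> A $$ (i, j) = p A"
    using covering by (simp add: universal_covering_def isogeny_def alg_hom_def)
  with ij obtain p where p: "p \<in> regular_funs base_field m" "\<forall>A\<in>Gsc. \<rho> A $$ (i, j) = p A"
    by blast
  then show "\<rho> (map_mat \<sigma> x) $$ (i, j) = map_mat \<sigma> (\<rho> x) $$ (i, j)"
    using regular_funs_map_mat_Gal[OF p(1) \<sigma> xM] \<sigma>x x ij by simp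
qed

end

section \<open>Hypercohomology\<close>

text \<open>A common interface for the two crossed modules, so that the theory of classes is
  developed once and instantiated twice.\<close>

locale galois_module_hom = group_hom "source M" "target M" "boundary M"
  for M :: "'k::field alg_closure crossed_module" +
  assumes Gal_hom: "\<sigma> \<in> Gal \<Longrightarrow> map_mat \<sigma> \<in> hom (source M) (source M)"
begin

lemma Gal_closed: "\<sigma> \<in> Gal \<Longrightarrow> f \<in> carrier (source M) \<Longrightarrow> map_mat \<sigma> f \<in> carrier (source M)"
  using Gal_hom by (auto simp: hom_def)

lemma Gal_mult:
  "\<sigma> \<in> Gal \<Longrightarrow> f \<in> carrier (source M) \<Longrightarrow> f' \<in> carrier (source M) \<Longrightarrow>
    map_mat \<sigma> (f \<otimes>\<^bsub>source M\<^esub> f') = map_mat \<sigma> f \<otimes>\<^bsub>source M\<^esub> map_mat \<sigma> f'"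
  using Gal_hom by (auto simp: hom_def)

lemma Gal_one: "\<sigma> \<in> Gal \<Longrightarrow> map_mat \<sigma> \<one>\<^bsub>source M\<^esub> = \<one>\<^bsub>source M\<^esub>"
  using Group.hom_one[OF Gal_hom] G.is_group by blast

lemma Z0_D:
  assumes "(\<phi>, g) \<in> Z0 M"
  shows "\<phi> \<in> extensional Gal" "\<sigma> \<in> Gal \<Longrightarrow> \<phi> \<sigma> \<in> carrier (source M)" "g \<in> carrier (target M)"
  using assms by (auto simp: Z0_def continuous_map_def topspace_krull)

lemma twist_one:
  assumes "x \<in> Z0 M"
  shows "twist M x \<one>\<^bsub>source M\<^esub> = x"
proof -
  obtain \<phi> g where x: "x = (\<phi>, g)" by (cases x)
  note D = Z0_D[OF assms[unfolded x]]
  \<comment> \<open>Extensionality of \<phi> is essential: \<open>twist\<close> returns a function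
    restricted to \<open>Gal\<close>.\<close>
  show ?thesis unfolding x twist_def prod.case
    using D by (auto simp: Gal_one extensional_def fun_eq_iff)
qed

lemma twist_mult:
  assumes "x \<in> Z0 M" "f \<in> carrier (source M)" "f' \<in> carrier (source M)"
  shows "twist M (twist M x f) f' = twist M x (f \<otimes>\<^bsub>source M\<^esub> f')"
proof -
  obtain \<phi> g where x: "x = (\<phi>, g)" by (cases x)
  note D = Z0_D[OF assms(1)[unfolded x]]
  have "inv\<^bsub>source M\<^esub> f' \<otimes>\<^bsub>source M\<^esub> (inv\<^bsub>source M\<^esub> f \<otimes>\<^bsub>source M\<^esub> \<phi> \<sigma> \<otimes>\<^bsub>source M\<^esub> map_mat \<sigma> f)
        \<otimes>\<^bsub>source M\<^esub> map_mat \<sigma> f' =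
      inv\<^bsub>source M\<^esub> (f \<otimes>\<^bsub>source M\<^esub> f') \<otimes>\<^bsub>source M\<^esub> \<phi> \<sigma> \<otimes>\<^bsub>source M\<^esub> map_mat \<sigma> (f \<otimes>\<^bsub>source M\<^esub> f')"
    if "\<sigma> \<in> Gal" for \<sigma>
    using assms(2,3) that D(2)[OF that] by (simp add: Gal_mult Gal_closed G.inv_mult_group G.m_assoc)
  moreover have "inv\<^bsub>target M\<^esub> boundary M f' \<otimes>\<^bsub>target M\<^esub> (inv\<^bsub>target M\<^esub> boundary M f \<otimes>\<^bsub>target M\<^esub> g) =
      inv\<^bsub>target M\<^esub> boundary M (f \<otimes>\<^bsub>source M\<^esub> f') \<otimes>\<^bsub>target M\<^esub> g"
    using assms(2,3) D(3) by (simp add: H.inv_mult_group H.m_assoc)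
  ultimately show ?thesis by (simp add: x twist_def fun_eq_iff)
qed

text \<open>Membership in \<open>Z0 M\<close> is built into the relation, so the three properties
  are the laws of a right action, \<open>twist_one\<close> and \<open>twist_mult\<close>.\<close>

lemma equiv_cohomologous: "equiv (Z0 M) (cohomologous M)"
proof (rule equivI)
  show "cohomologous M \<subseteq> Z0 M \<times> Z0 M" by (auto simp: cohomologous_def)
  show "refl_on (Z0 M) (cohomologous M)"
  proof (rule refl_onI)
    fix x assume x: "x \<in> Z0 M"
    have "x = twist M x \<one>\<^bsub>source M\<^esub>" using twist_one[OF x] by simp
    then show "(x, x) \<in> cohomologous M" unfolding cohomologous_def using x G.one_closed by blast
  qed
  show "sym (cohomologous M)"
  proof (rule symI)
    fix x y assume "(x, y) \<in> cohomologous M"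
    then obtain f where xy: "x \<in> Z0 M" "y \<in> Z0 M" and f: "f \<in> carrier (source M)" "y = twist M x f"
      by (auto simp: cohomologous_def)
    have "x = twist M y (inv\<^bsub>source M\<^esub> f)"
      using twist_mult[OF xy(1) f(1) G.inv_closed[OF f(1)]] twist_one[OF xy(1)] f by simp
    then show "(y, x) \<in> cohomologous M" unfolding cohomologous_def using xy G.inv_closed[OF f(1)] by blast
  qed
  show "trans (cohomologous M)"
  proof (rule transI)
    fix x y w assume "(x, y) \<in> cohomologous M" "(y, w) \<in> cohomologous M"
    then obtain f f' where "x \<in> Z0 M" "y \<in> Z0 M" "w \<in> Z0 M"
      and f: "f \<in> carrier (source M)" "y = twist M x f" "f' \<in> carrier (source M)" "w = twist M y f'"
      by (auto simp: cohomologous_def)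
    moreover from this have "w = twist M x (f \<otimes>\<^bsub>source M\<^esub> f')" using twist_mult by simp
    ultimately show "(x, w) \<in> cohomologous M"
      unfolding cohomologous_def using G.m_closed[OF f(1,3)] by blast
  qed
qed

lemma Cl_eq_iff: "x \<in> Z0 M \<Longrightarrow> y \<in> Z0 M \<Longrightarrow> Cl M x = Cl M y \<longleftrightarrow> (x, y) \<in> cohomologous M"
  unfolding Cl_def by (rule eq_equiv_class_iff[OF equiv_cohomologous])

lemma Cl_self: "x \<in> Z0 M \<Longrightarrow> x \<in> Cl M x"
  unfolding Cl_def by (rule equiv_class_self[OF equiv_cohomologous])

end

text \<open>The cocycle identity for \<phi>, with a, b, c the elements g', \<sigma> g' and \<sigma>
  \<tau> g'.\<close>

lemma (in group) quotient_telescope: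
  assumes "a \<in> carrier G" "b \<in> carrier G" "c \<in> carrier G"
  shows "inv a \<otimes> c = (inv a \<otimes> b) \<otimes> (inv b \<otimes> c)"
proof -
  have "b \<otimes> (inv b \<otimes> c) = c" using assms by (simp add: m_assoc[symmetric])
  then show ?thesis using assms by (simp add: m_assoc)
qed

text \<open>Applied to r = \<rho>(g'), s = \<sigma> r and w = \<sigma> z, where the last hypothesis
  expresses that g is Galois invariant.\<close>

lemma (in group) quotient_swap:
  assumes "r \<in> carrier G" "s \<in> carrier G" "z \<in> carrier G" "w \<in> carrier G" "r \<otimes> z = s \<otimes> w"
  shows "inv r \<otimes> s = z \<otimes> inv w" "w = inv (inv r \<otimes> s) \<otimes> z"
proof -
  have "z \<otimes> inv w = inv r \<otimes> (r \<otimes> z) \<otimes> inv w" using assms(1-4) by (simp add: m_assoc[symmetric])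
  also have "\<dots> = inv r \<otimes> s" using assms(1-4) unfolding assms(5) by (simp add: m_assoc)
  finally show rs: "inv r \<otimes> s = z \<otimes> inv w" by simp
  show "w = inv (inv r \<otimes> s) \<otimes> z"
    using assms(3,4) unfolding rs by (simp add: inv_mult_group m_assoc)
qed

lemma (in group) quotient_solve:
  assumes "r \<in> carrier G" "g \<in> carrier G" "h = inv r \<otimes> g"
  shows "r = g \<otimes> inv h"
  using assms(1,2) by (simp add: assms(3) inv_mult_group m_assoc[symmetric])

text \<open>Continuity in \<open>Z0\<close> refers to the carrier of the source, which grows from
  \<open>Zsc\<close> to \<open>Gsc\<close> when the crossed module changes.\<close>

lemma continuous_map_discrete_mono:
  assumes "continuous_map T (discrete_topology A) f" "A \<subseteq> B"
  shows "continuous_map T (discrete_topology B) f"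
proof -
  have "discrete_topology A = subtopology (discrete_topology B) A"
    using assms(2) by (simp add: Int_absorb1)
  with assms(1) have "continuous_map T (subtopology (discrete_topology B) A) f" by (simp only:)
  then show ?thesis by (rule continuous_map_into_fulltopology)
qed

section \<open>Comparing the crossed module of centers with that of \<open>Gsc\<close> and
  \<open>G\<close>\<close>

context reductive_covering
begin

abbreviation "Zsc \<equiv> center (grp m Gsc)"
abbreviation "Z \<equiv> center (grp n G)"
abbreviation "sc_mod \<equiv> sc_module n G m Gsc \<rho>"
abbreviation "center_mod \<equiv> center_module n G m Gsc \<rho>"

lemma sc_mod_simps [simp]:
  "source sc_mod = grp m Gsc" "target sc_mod = grp n G" "boundary sc_mod = \<rho>"
  by (simp_all add: sc_module_def)

lemma center_mod_simps [simp]: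
  "source center_mod = grp m Zsc" "target center_mod = grp n Z" "boundary center_mod = \<rho>"
  by (simp_all add: center_module_def)

lemma Zsc_subset: "x \<in> Zsc \<Longrightarrow> x \<in> Gsc" and Z_subset: "y \<in> Z \<Longrightarrow> y \<in> G"
  by (simp_all add: center_grp)

lemma Zsc_subgroup: "subgroup Zsc (GL m)" by (rule subgroup_center_GL[OF Gsc_subgroup])

lemma Z_subgroup: "subgroup Z (GL n)" by (rule subgroup_center_GL[OF G_subgroup])

text \<open>Inverses depend formally on the carrier of the structure; those in the groups and in
  their centers are all reduced to inverses in \<open>GL\<close>.\<close>

lemma inv_simps:
  "x \<in> Gsc \<Longrightarrow> inv\<^bsub>grp m Gsc\<^esub> x = inv\<^bsub>GL m\<^esub> x" "x \<in> Zsc \<Longrightarrow> inv\<^bsub>grp m Zsc\<^esub> x = inv\<^bsub>GL m\<^esub> x"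
  "y \<in> G \<Longrightarrow> inv\<^bsub>grp n G\<^esub> y = inv\<^bsub>GL n\<^esub> y" "y \<in> Z \<Longrightarrow> inv\<^bsub>grp n Z\<^esub> y = inv\<^bsub>GL n\<^esub> y"
  by (rule GLm.m_inv_consistent GLn.m_inv_consistent, rule Gsc_subgroup Zsc_subgroup G_subgroup
      Z_subgroup, assumption)+

lemma map_mat_Gal_Gsc: "\<sigma> \<in> Gal \<Longrightarrow> map_mat \<sigma> x \<in> Gsc \<longleftrightarrow> x \<in> Gsc"
  by (rule alg_group_map_mat_Gal[OF Gsc_alg])

lemma map_mat_Gal_G: "\<sigma> \<in> Gal \<Longrightarrow> map_mat \<sigma> x \<in> G \<longleftrightarrow> x \<in> G"
  by (rule alg_group_map_mat_Gal[OF G_alg])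

sublocale sc: galois_module_hom sc_mod
proof (intro galois_module_hom.intro galois_module_hom_axioms.intro)
  show "group_hom (source sc_mod) (target sc_mod) (boundary sc_mod)"
    by (simp add: rho.group_hom_axioms)
  show "map_mat \<sigma> \<in> hom (source sc_mod) (source sc_mod)" if "\<sigma> \<in> Gal" for \<sigma>
    using map_mat_Gal_hom[OF that Gsc_subgroup] map_mat_Gal_Gsc[OF that] by simp
qed

sublocale cen: galois_module_hom center_mod
proof (intro galois_module_hom.intro galois_module_hom_axioms.intro)
  \<comment> \<open>Here \<open>rho_center\<close> is what allows \<open>Z\<close> as the
    codomain.\<close>
  have "\<rho> \<in> hom (grp m Zsc) (grp n Z)"
    by (rule homI) (auto simp: rho_center rho_mult Zsc_subset)
  then show "group_hom (source center_mod) (target center_mod) (boundary center_mod)"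
    using GLm.subgroup_imp_group[OF Zsc_subgroup] GLn.subgroup_imp_group[OF Z_subgroup]
    by (simp add: group_hom_def group_hom_axioms_def)
  show "map_mat \<sigma> \<in> hom (source center_mod) (source center_mod)" if "\<sigma> \<in> Gal" for \<sigma>
    using map_mat_Gal_hom[OF that Zsc_subgroup] center_map_mat_Gal[OF Gsc_alg that] by simp
qed

lemma Z0_center_subset:
  assumes "x \<in> Z0 center_mod"
  shows "x \<in> Z0 sc_mod"
proof -
  obtain \<phi> g where x: "x = (\<phi>, g)" by (cases x)
  have D: "\<phi> \<sigma> \<in> Zsc" if "\<sigma> \<in> Gal" for \<sigma>
    using cen.Z0_D(2)[OF assms[unfolded x] that] by simp
  have "continuous_map krull (discrete_topology Zsc) \<phi>" using assms x by (simp add: Z0_def)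
  then have "continuous_map krull (discrete_topology Gsc) \<phi>"
    by (rule continuous_map_discrete_mono) (use Zsc_subset in blast)
  moreover have "g \<in> G" using cen.Z0_D(3)[OF assms[unfolded x]] Z_subset by simp
  moreover have "inv\<^bsub>grp m Zsc\<^esub> \<phi> \<sigma> = inv\<^bsub>grp m Gsc\<^esub> \<phi> \<sigma>" if "\<sigma> \<in> Gal" for \<sigma>
    using D[OF that] Zsc_subset by (simp add: inv_simps)
  ultimately show ?thesis using assms unfolding x Z0_def by simp
qed

lemma twist_center:
  assumes "x \<in> Z0 center_mod" "f \<in> Zsc"
  shows "twist center_mod x f = twist sc_mod x f"
  using assms by (cases x) (simp add: twist_def inv_simps rho_center Zsc_subset Z_subset)

text \<open>The content is that no new identifications arise: an f in \<open>Gsc\<close> relating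
  two cocycles of the centers has \<rho>(f) = g h^-1 in \<open>Z\<close>, so f is in
  \<open>Zsc\<close>.\<close>

lemma cohomologous_center:
  assumes "x \<in> Z0 center_mod" "y \<in> Z0 center_mod"
  shows "(x, y) \<in> cohomologous center_mod \<longleftrightarrow> (x, y) \<in> cohomologous sc_mod"
proof
  assume "(x, y) \<in> cohomologous center_mod"
  then obtain f where "f \<in> Zsc" "y = twist center_mod x f" by (auto simp: cohomologous_def)
  then have "f \<in> Gsc" "y = twist sc_mod x f" using twist_center[OF assms(1)] Zsc_subset by auto
  then show "(x, y) \<in> cohomologous sc_mod"
    using assms Z0_center_subset unfolding cohomologous_def by auto
next
  assume "(x, y) \<in> cohomologous sc_mod"
  then obtain f where f: "f \<in> Gsc" "y = twist sc_mod x f" by (auto simp: cohomologous_def)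
  obtain \<phi> g \<psi> h where xy: "x = (\<phi>, g)" "y = (\<psi>, h)" by (cases x, cases y)
  have gh: "g \<in> Z" "h \<in> Z"
    using cen.Z0_D(3)[OF assms(1)[unfolded xy]] cen.Z0_D(3)[OF assms(2)[unfolded xy]] by simp_all
  have "h = inv\<^bsub>grp n G\<^esub> \<rho> f \<otimes>\<^bsub>grp n G\<^esub> g" using f(2) xy by (simp add: twist_def)
  from G.quotient_solve[OF _ _ this] have "\<rho> f = g \<otimes>\<^bsub>grp n G\<^esub> inv\<^bsub>grp n G\<^esub> h"
    using rho_closed[OF f(1)] Z_subset[OF gh(1)] by simp
  moreover have "g \<otimes>\<^bsub>grp n G\<^esub> inv\<^bsub>grp n G\<^esub> h \<in> Z"
    by (intro subgroup.m_closed[OF G.subgroup_center] subgroup.m_inv_closed[OF G.subgroup_center] gh)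
  ultimately have "\<rho> f \<in> Z" by (simp only:)
  then have "f \<in> Zsc" using center_if_rho_center[OF f(1)] by blast
  then show "(x, y) \<in> cohomologous center_mod"
    using assms f(2) twist_center[OF assms(1)] unfolding cohomologous_def by auto
qed

text \<open>All members of the class contribute the same set to the union in \<open>H0_map\<close>,
  and the class is nonempty, so the union is that set and not the empty default.\<close>

lemma H0_map_center:
  assumes x: "x \<in> Z0 center_mod"
  shows "H0_map sc_mod id id (Cl center_mod x) = Cl sc_mod x"
proof -
  have "Cl sc_mod (\<lambda>\<sigma>\<in>Gal. id (\<phi> \<sigma>), id g) = Cl sc_mod x" if "(\<phi>, g) \<in> Cl center_mod x" for \<phi> g
  proof -
    have xy: "(x, (\<phi>, g)) \<in> cohomologous center_mod" using that by (simp add: Cl_def)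
    then have y: "(\<phi>, g) \<in> Z0 center_mod" by (simp add: cohomologous_def)
    have "(\<lambda>\<sigma>\<in>Gal. id (\<phi> \<sigma>)) = \<phi>" using cen.Z0_D(1)[OF y] by (simp add: extensional_restrict)
    moreover have "Cl sc_mod x = Cl sc_mod (\<phi>, g)"
      using xy cohomologous_center[OF x y] sc.Cl_eq_iff Z0_center_subset x y by simp
    ultimately show ?thesis by simp
  qed
  then have "(case y of (\<phi>, g) \<Rightarrow> Cl sc_mod (\<lambda>\<sigma>\<in>Gal. id (\<phi> \<sigma>), id g)) = Cl sc_mod x"
    if "y \<in> Cl center_mod x" for y using that by (cases y) simp
  moreover have "Cl center_mod x \<noteq> {}" using cen.Cl_self[OF x] by blast
  ultimately show ?thesis unfolding H0_map_def by (intro SUP_eq_const)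
qed

lemma inj_on_H0_map: "inj_on (H0_map sc_mod id id) (H0 center_mod)"
proof (rule inj_onI)
  fix c d assume cd: "c \<in> H0 center_mod" "d \<in> H0 center_mod"
    and eq: "H0_map sc_mod id id c = H0_map sc_mod id id d"
  obtain x where x: "x \<in> Z0 center_mod" "c = Cl center_mod x"
    using cd(1) unfolding H0_def Cl_def by (rule quotientE)
  obtain y where y: "y \<in> Z0 center_mod" "d = Cl center_mod y"
    using cd(2) unfolding H0_def Cl_def by (rule quotientE)
  have "(x, y) \<in> cohomologous sc_mod"
    using eq x y H0_map_center sc.Cl_eq_iff Z0_center_subset by metis
  then show "c = d" using cohomologous_center x y cen.Cl_eq_iff by metis
qed

end

section \<open>The cocycle of a decomposed rational point\<close>

locale decomposed_point = reductive_covering n m G Gsc \<rho>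
  for n m and G Gsc :: "'k::field alg_closure mat set" and \<rho> +
  fixes g g' z :: "'k alg_closure mat" and \<phi> :: "('k alg_closure \<Rightarrow> 'k alg_closure) \<Rightarrow> 'k alg_closure mat"
  assumes g: "g \<in> H0_gal G" and g': "g' \<in> Gsc" and z: "z \<in> Z"
    and g_eq: "g = \<rho> g' \<otimes>\<^bsub>GL n\<^esub> z"
    and \<phi>_eq: "\<phi> = (\<lambda>\<sigma>\<in>Gal. inv\<^bsub>GL m\<^esub> g' \<otimes>\<^bsub>GL m\<^esub> map_mat \<sigma> g')"
begin

lemma phi_apply: "\<sigma> \<in> Gal \<Longrightarrow> \<phi> \<sigma> = inv\<^bsub>grp m Gsc\<^esub> g' \<otimes>\<^bsub>grp m Gsc\<^esub> map_mat \<sigma> g'"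
  using g' by (simp add: \<phi>_eq inv_simps)

lemma phi_Gsc: "\<sigma> \<in> Gal \<Longrightarrow> \<phi> \<sigma> \<in> Gsc"
  using Gsc.m_closed[of "inv\<^bsub>grp m Gsc\<^esub> g'" "map_mat \<sigma> g'"] Gsc.inv_closed[of g'] g'
  by (simp add: phi_apply map_mat_Gal_Gsc)

text \<open>Apply \<sigma> to g = \<rho>(g') z and compare with g itself. The first form shows that
  \<phi>(\<sigma>) lies over the center, the second is the cocycle condition on z.\<close>

lemma rho_phi_map_mat_z:
  assumes \<sigma>: "\<sigma> \<in> Gal"
  shows "\<rho> (\<phi> \<sigma>) = z \<otimes>\<^bsub>grp n G\<^esub> inv\<^bsub>grp n G\<^esub> map_mat \<sigma> z"
    and "map_mat \<sigma> z = inv\<^bsub>grp n G\<^esub> \<rho> (\<phi> \<sigma>) \<otimes>\<^bsub>grp n G\<^esub> z"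
proof -
  let ?r = "\<rho> g'"
  have cl: "?r \<in> G" "map_mat \<sigma> ?r \<in> G" "z \<in> G" "map_mat \<sigma> z \<in> G"
    using rho_closed[OF g'] Z_subset[OF z] map_mat_Gal_G[OF \<sigma>] by auto
  then have M: "?r \<in> carrier_mat n n" "z \<in> carrier_mat n n" using G_carrier GL_carrier_mat by blast+
  have "map_mat \<sigma> g = g" using g \<sigma> by (simp add: H0_gal_def)
  then have "?r * z = map_mat \<sigma> ?r * map_mat \<sigma> z"
    using map_mat_Gal_mult[OF \<sigma> M] g_eq by simp
  then have eq: "?r \<otimes>\<^bsub>grp n G\<^esub> z = map_mat \<sigma> ?r \<otimes>\<^bsub>grp n G\<^esub> map_mat \<sigma> z" by simp
  have "\<rho> (\<phi> \<sigma>) = inv\<^bsub>grp n G\<^esub> ?r \<otimes>\<^bsub>grp n G\<^esub> map_mat \<sigma> ?r"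
    using rho.hom_mult[of "inv\<^bsub>grp m Gsc\<^esub> g'" "map_mat \<sigma> g'"] rho.hom_inv[of g']
      Gsc.inv_closed[of g'] g' map_mat_Gal_Gsc[OF \<sigma>]
    by (simp add: phi_apply[OF \<sigma>] rho_map_mat_Gal[OF \<sigma> g'])
  with G.quotient_swap[OF _ _ _ _ eq] cl
  show "\<rho> (\<phi> \<sigma>) = z \<otimes>\<^bsub>grp n G\<^esub> inv\<^bsub>grp n G\<^esub> map_mat \<sigma> z"
    and "map_mat \<sigma> z = inv\<^bsub>grp n G\<^esub> \<rho> (\<phi> \<sigma>) \<otimes>\<^bsub>grp n G\<^esub> z" by auto
qed

lemma phi_center:
  assumes \<sigma>: "\<sigma> \<in> Gal"
  shows "\<phi> \<sigma> \<in> Zsc"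
proof (rule center_if_rho_center[OF phi_Gsc[OF \<sigma>]])
  show "\<rho> (\<phi> \<sigma>) \<in> Z"
    unfolding rho_phi_map_mat_z(1)[OF \<sigma>]
    by (intro subgroup.m_closed[OF G.subgroup_center] subgroup.m_inv_closed[OF G.subgroup_center]
        z center_map_mat_Gal[OF G_alg \<sigma> z])
qed

lemma phi_cocycle:
  assumes \<sigma>: "\<sigma> \<in> Gal" and \<tau>: "\<tau> \<in> Gal"
  shows "\<phi> (\<sigma> \<circ> \<tau>) = \<phi> \<sigma> \<otimes>\<^bsub>grp m Gsc\<^esub> map_mat \<sigma> (\<phi> \<tau>)"
proof -
  interpret s: group_hom "grp m Gsc" "grp m Gsc" "map_mat \<sigma>"
    by unfold_locales (use sc.Gal_hom[OF \<sigma>] in simp)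
  have cl: "g' \<in> carrier (grp m Gsc)" "map_mat \<sigma> g' \<in> carrier (grp m Gsc)"
    "map_mat \<tau> g' \<in> carrier (grp m Gsc)" "map_mat \<sigma> (map_mat \<tau> g') \<in> carrier (grp m Gsc)"
    using g' map_mat_Gal_Gsc \<sigma> \<tau> by auto
  have "map_mat \<sigma> (\<phi> \<tau>) =
      inv\<^bsub>grp m Gsc\<^esub> (map_mat \<sigma> g') \<otimes>\<^bsub>grp m Gsc\<^esub> map_mat \<sigma> (map_mat \<tau> g')"
    unfolding phi_apply[OF \<tau>] s.hom_mult[OF Gsc.inv_closed[OF cl(1)] cl(3)] s.hom_inv[OF cl(1)] ..
  moreover have "map_mat (\<sigma> \<circ> \<tau>) g' = map_mat \<sigma> (map_mat \<tau> g')" by (intro eq_matI) auto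
  ultimately show ?thesis
    unfolding phi_apply[OF Gal_comp[OF \<sigma> \<tau>]] phi_apply[OF \<sigma>]
    using Gsc.quotient_telescope[OF cl(1,2,4)] by simp
qed

lemma phi_z_Z0: "(\<phi>, z) \<in> Z0 center_mod"
proof -
  have "continuous_map krull (discrete_topology Zsc) \<phi>"
    unfolding \<phi>_eq using phi_center
    by (intro continuous_map_krull_map_mat) (simp add: \<phi>_eq)
  moreover have "map_mat \<sigma> z = \<rho> (inv\<^bsub>grp m Zsc\<^esub> \<phi> \<sigma>) \<otimes>\<^bsub>grp n Z\<^esub> z" if "\<sigma> \<in> Gal" for \<sigma>
    using rho_phi_map_mat_z(2)[OF that] rho.hom_inv[of "\<phi> \<sigma>"] phi_Gsc[OF that] phi_center[OF that]
    by (simp add: inv_simps)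
  moreover have "\<phi> \<in> extensional Gal" by (simp add: \<phi>_eq)
  ultimately show ?thesis using z phi_cocycle by (simp add: Z0_def)
qed

lemma trivial_g_Z0: "(\<lambda>\<sigma>\<in>Gal. \<one>\<^bsub>source sc_mod\<^esub>, g) \<in> Z0 sc_mod"
proof -
  have one: "1\<^sub>m m \<in> Gsc" using Gsc.one_closed by simp
  have gG: "g \<in> G" "\<And>\<sigma>. \<sigma> \<in> Gal \<Longrightarrow> map_mat \<sigma> g = g" using g by (auto simp: H0_gal_def)
  have "continuous_map krull (discrete_topology Gsc) (\<lambda>\<sigma>\<in>Gal. (\<lambda>_. 1\<^sub>m m) (map_mat \<sigma> g))"
    using one by (intro continuous_map_krull_map_mat)
  moreover have "\<rho> (inv\<^bsub>grp m Gsc\<^esub> 1\<^sub>m m) \<otimes>\<^bsub>grp n G\<^esub> g = g"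
    using Gsc.inv_one rho.hom_one G.l_one[of g] gG by simp
  moreover have "1\<^sub>m m = 1\<^sub>m m \<otimes>\<^bsub>grp m Gsc\<^esub> map_mat \<sigma> (1\<^sub>m m)" if "\<sigma> \<in> Gal" for \<sigma>
    using sc.Gal_one[OF that] by simp
  ultimately show ?thesis using gG by (simp add: Z0_def Gal_comp)
qed

lemma kappa0_eq: "kappa0 sc_mod g = Cl sc_mod (\<phi>, z)"
proof -
  have rg: "\<rho> g' \<in> carrier (grp n G)" and zG: "z \<in> carrier (grp n G)"
    using rho_closed[OF g'] Z_subset[OF z] by simp_all
  have "inv\<^bsub>grp n G\<^esub> \<rho> g' \<otimes>\<^bsub>grp n G\<^esub> (\<rho> g' \<otimes>\<^bsub>grp n G\<^esub> z) = z"
    using G.m_assoc[OF G.inv_closed[OF rg] rg zG] G.l_inv[OF rg] G.l_one[OF zG] by simp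
  then have "inv\<^bsub>grp n G\<^esub> \<rho> g' \<otimes>\<^bsub>grp n G\<^esub> g = z" using g_eq by simp
  moreover have "inv\<^bsub>grp m Gsc\<^esub> g' \<otimes>\<^bsub>grp m Gsc\<^esub> \<one>\<^bsub>grp m Gsc\<^esub> \<otimes>\<^bsub>grp m Gsc\<^esub> map_mat \<sigma> g' = \<phi> \<sigma>"
    if "\<sigma> \<in> Gal" for \<sigma>
    unfolding phi_apply[OF that] using Gsc.r_one[OF Gsc.inv_closed, of g'] g' by simp
  \<comment> \<open>Needed for equality of functions: off \<open>Gal\<close> the twisted cocycle is
    \<open>undefined\<close> as well.\<close>
  moreover have "\<phi> \<sigma> = undefined" if "\<sigma> \<notin> Gal" for \<sigma> using that by (simp add: \<phi>_eq)
  ultimately have "(\<phi>, z) = twist sc_mod (\<lambda>\<sigma>\<in>Gal. \<one>\<^bsub>source sc_mod\<^esub>, g) g'"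
    by (simp add: twist_def restrict_def fun_eq_iff)
  then have "((\<lambda>\<sigma>\<in>Gal. \<one>\<^bsub>source sc_mod\<^esub>, g), (\<phi>, z)) \<in> cohomologous sc_mod"
    using trivial_g_Z0 Z0_center_subset[OF phi_z_Z0] g' unfolding cohomologous_def by auto
  then show ?thesis
    unfolding kappa0_def
    using sc.Cl_eq_iff[OF trivial_g_Z0 Z0_center_subset[OF phi_z_Z0]] by blast
qed

lemma Cl_in_H0_ab: "Cl center_mod (\<phi>, z) \<in> H0_ab n G m Gsc \<rho>"
  unfolding H0_ab_def H0_def Cl_def using phi_z_Z0 by (rule quotientI)

text \<open>The class of (1, g) is rewritten as the image of the class of (\<phi>, z) under the
  comparison map, and injectivity on \<open>H0\<close> lets \<open>the_inv_into\<close> return that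
  class.\<close>

lemma ab0_eq: "ab0 n G m Gsc \<rho> g = Cl center_mod (\<phi>, z)"
  unfolding ab0_def kappa0_eq H0_map_center[OF phi_z_Z0, symmetric]
  using inj_on_H0_map Cl_in_H0_ab by (intro the_inv_into_f_f) (simp_all add: H0_ab_def)

end

theorem proposition4p3p1:
  fixes n m :: nat
    and G Gsc :: "'k::field_char_0 alg_closure mat set"
    and \<rho> :: "'k alg_closure mat \<Rightarrow> 'k alg_closure mat"
    and g g' z :: "'k alg_closure mat"
    and \<phi> :: "('k alg_closure \<Rightarrow> 'k alg_closure) \<Rightarrow> 'k alg_closure mat"
  assumes "alg_group base_field n G"
    and "connected_reductive n G"
    and "universal_covering n G m Gsc \<rho>"
    and "g \<in> H0_gal G"
    and "g' \<in> Gsc"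
    and "z \<in> center (grp n G)"
    and "g = \<rho> g' \<otimes>\<^bsub>GL n\<^esub> z"
    and "\<phi> = (\<lambda>\<sigma>\<in>Gal. inv\<^bsub>GL m\<^esub> g' \<otimes>\<^bsub>GL m\<^esub> map_mat \<sigma> g')"
  shows "\<phi> \<in> Gal \<rightarrow> center (grp m Gsc) \<and>
    Cl (center_module n G m Gsc \<rho>) (\<phi>, z) \<in> H0_ab n G m Gsc \<rho> \<and>
    ab0 n G m Gsc \<rho> g = Cl (center_module n G m Gsc \<rho>) (\<phi>, z)"
proof -
  interpret decomposed_point n m G Gsc \<rho> g g' z \<phi>
    using assms by unfold_locales
  show ?thesis using phi_center Cl_in_H0_ab ab0_eq by blast
qed

end
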